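(* Let $k\ge1$ and $\epsilon\ge0$. Consider an $n$-player game with tree-form strategy sets $\mathcal X_1,\dots,\mathcal X_n$ and multilinear utilities $u_i$. For every $\epsilon$-linear-swap equilibrium $\pi\in\Delta(\mathcal X_1\times\dots\times\mathcal X_n)$ there exist tree-form decision problems $\mathcal Y_1,\dots,\mathcal Y_n$, $k$-mediator deviations $\phi_i\in\Phi^k_{\mathrm{med}}(\mathcal Y_i\to\mathcal X_i)$ with $\phi_i(\mathcal Y_i)\subseteq\mathcal X_i$, and a distribution $\pi'\in\Delta(\mathcal Y_1\times\dots\times\mathcal Y_n)$ such that $((\mathcal Y_i,\phi_i)_{i=1}^n,\pi')$ is a generalized $\epsilon$-$\Phi^k_{\mathrm{med}}$-equilibrium whose induced canonical profile is $\pi$.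
   Context: A tree-form decision problem is a finite rooted tree with decision points (player picks a child) and observation points (environment picks a child), alternating along root-to-leaf paths; pure strategies are represented by $\vec x\in\{0,1\}^{\mathcal Z}$ ($\mathcal Z$ = terminal nodes) with $\vec x[z]=1$ iff all actions on the root-to-$z$ path are played. The dual $\bar{\mathcal Y}$ swaps decision and observation points. The interleaving $\mathcal X\otimes\mathcal Y_1\otimes\dots\otimes\mathcal Y_k$ has as histories sequences of state tuples starting at the roots; a state is terminal iff all components are terminal; the environment moves every component at an observation point; otherwise the player chooses a non-terminal component and a child of it. A reduced strategy $\vec q$ assigns to each terminal state $(z,z_1,\dots,z_k)$ the total weight of (a mixed strategy on) terminal histories ending there. $\Phi^k_{\mathrm{med}}(\mathcal Y\to\mathcal X)$ is the set of maps $\phi_{\vec q}:\mathcal Y\to\mathrm{co}\,\mathcal X$, $\phi_{\vec q}(\vec y)[z]=\sum_{z_1,\dots,z_k}\vec q[z,z_1,\dots,z_k]\prod_{i=1}^k\vec y[z_i]$, $\vec q$ a reduced strategy of $\mathcal X\otimes\bar{\mathcal Y}^{\otimes k}$. A linear-swap deviation is a map $\mathcal X_i\to\mathrm{co}\,\mathcal X_i$ that is the restriction of a linear map; $\pi$ is an $\epsilon$-linear-swap equilibrium if no player gains more than $\epsilon$ by applying such a map to its sampled strategy: $\mathbb E_{\vec x\sim\pi}u_i(\psi(\vec x_i),\vec x_{-i})\le\mathbb E_{\vec x\sim\pi}u_i(\vec x)+\epsilon$. A generalized profile $((\mathcal Y_i,\phi_i)_i,\pi')$ is a generalized $\epsilon$-$\Phi^k_{\mathrm{med}}$-equilibrium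 if for every $i$ and every $\phi_i'\in\Phi^k_{\mathrm{med}}(\mathcal Y_i\to\mathcal X_i)$, $\mathbb E_{\vec y\sim\pi'}u_i(\phi_i'(\vec y_i),\phi_{-i}(\vec y_{-i}))\le\mathbb E_{\vec y\sim\pi'}u_i(\phi_i(\vec y_i),\phi_{-i}(\vec y_{-i}))+\epsilon$ (utilities extended multilinearly). When every $\phi_i$ maps $\mathcal Y_i$ into $\mathcal X_i$, its induced canonical profile is the distribution of $(\phi_1(\vec y_1),\dots,\phi_n(\vec y_n))$ for $\vec y\sim\pi'$. *)

theory Defs
  imports "HOL-Probability.Probability"
begin

text \<open>A finite rooted tree: leaves (terminal nodes), decision points and observation
  points; the children of a node are indexed 0,1,... Nodes are identified by their
  address (list of child indices from the root).\<close>

datatype tree = Leaf | Dec "tree list" | Obs "tree list"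

fun children :: "tree \<Rightarrow> tree list" where
  "children Leaf = []"
| "children (Dec ts) = ts"
| "children (Obs ts) = ts"

fun is_dec :: "tree \<Rightarrow> bool" where
  "is_dec (Dec _) = True"
| "is_dec _ = False"

fun is_obs :: "tree \<Rightarrow> bool" where
  "is_obs (Obs _) = True"
| "is_obs _ = False"

primrec dual :: "tree \<Rightarrow> tree" where
  "dual Leaf = Leaf"
| "dual (Dec ts) = Obs (map dual ts)"
| "dual (Obs ts) = Dec (map dual ts)"

fun nodeat :: "tree \<Rightarrow> nat list \<Rightarrow> tree option" where
  "nodeat t [] = Some t"
| "nodeat t (a # p) = (if a < length (children t) then nodeat (children t ! a) p else None)"

definition leaves :: "tree \<Rightarrow> nat list set" where
  "leaves t = {p. nodeat t p = Some Leaf}"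

definition wf_tree :: "tree \<Rightarrow> bool" where
  "wf_tree t \<longleftrightarrow> (\<forall>p t'. nodeat t p = Some t' \<longrightarrow>
      (t' \<noteq> Leaf \<longrightarrow> children t' \<noteq> []) \<and>
      (is_dec t' \<longrightarrow> (\<forall>c \<in> set (children t'). \<not> is_dec c)) \<and>
      (is_obs t' \<longrightarrow> (\<forall>c \<in> set (children t'). \<not> is_obs c)))"

type_synonym vec = "nat list \<Rightarrow> real"

text \<open>Pure strategies as vectors \<open>x \<in> {0,1}^\<Z>\<close> (zero outside the terminal nodes):
  \<open>x[z] = 1\<close> iff all actions on the root-to-z path are played.\<close>
inductive pure_strat :: "tree \<Rightarrow> vec \<Rightarrow> bool" where
  leaf: "pure_strat Leaf (\<lambda>p. if p = [] then 1 else 0)"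
| dec: "i < length ts \<Longrightarrow> pure_strat (ts ! i) x \<Longrightarrow>
      pure_strat (Dec ts) (\<lambda>p. case p of [] \<Rightarrow> 0 | a # q \<Rightarrow> if a = i then x q else 0)"
| obs: "(\<forall>i < length ts. pure_strat (ts ! i) (xs i)) \<Longrightarrow>
      pure_strat (Obs ts) (\<lambda>p. case p of [] \<Rightarrow> 0 | a # q \<Rightarrow> if a < length ts then xs a q else 0)"

definition strats :: "tree \<Rightarrow> vec set" where
  "strats t = Collect (pure_strat t)"

definition cohull :: "('a \<Rightarrow> real) set \<Rightarrow> ('a \<Rightarrow> real) set" where
  "cohull A = {(\<lambda>p. \<Sum>x\<in>S. w x * x p) | S w. finite S \<and> S \<subseteq> A \<and> S \<noteq> {} \<and>
                 (\<forall>x\<in>S. 0 \<le> w x) \<and> sum w S = 1}"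

definition linear_fn :: "(vec \<Rightarrow> vec) \<Rightarrow> bool" where
  "linear_fn L \<longleftrightarrow> (\<forall>x y. L (\<lambda>p. x p + y p) = (\<lambda>p. L x p + L y p)) \<and>
                    (\<forall>c x. L (\<lambda>p. c * x p) = (\<lambda>p. c * L x p))"

text \<open>Components \<open>comps\<close> (a list of trees); a state is a list of node addresses, one per
  component.\<close>

type_synonym state = "nat list list"

definition cur :: "tree list \<Rightarrow> state \<Rightarrow> nat \<Rightarrow> tree" where
  "cur comps s j = the (nodeat (comps ! j) (s ! j))"

definition root_state :: "tree list \<Rightarrow> state" where
  "root_state comps = map (\<lambda>_. []) comps"

definition terminal_state :: "tree list \<Rightarrow> state \<Rightarrow> bool" where
  "terminal_state comps s \<longleftrightarrow> (\<forall>j < length s. cur comps s j = Leaf)"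

definition has_obs :: "tree list \<Rightarrow> state \<Rightarrow> bool" where
  "has_obs comps s \<longleftrightarrow> (\<exists>j < length s. is_obs (cur comps s j))"

definition obs_succ :: "tree list \<Rightarrow> state \<Rightarrow> state set" where
  "obs_succ comps s = {s'. length s' = length s \<and> (\<forall>j < length s.
      if is_obs (cur comps s j)
      then (\<exists>a < length (children (cur comps s j)). s' ! j = s ! j @ [a])
      else s' ! j = s ! j)}"

definition dec_succ :: "tree list \<Rightarrow> state \<Rightarrow> state set" where
  "dec_succ comps s = {s[j := s ! j @ [a]] | j a. j < length s \<and> cur comps s j \<noteq> Leaf \<and>
      a < length (children (cur comps s j))}"

definition succ :: "tree list \<Rightarrow> state \<Rightarrow> state set" where
  "succ comps s = (if has_obs comps s then obs_succ comps s else dec_succ comps s)"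

inductive thist :: "tree list \<Rightarrow> state \<Rightarrow> state list \<Rightarrow> bool" for comps where
  stop: "terminal_state comps s \<Longrightarrow> thist comps s []"
| step: "\<not> terminal_state comps s \<Longrightarrow> s' \<in> succ comps s \<Longrightarrow> thist comps s' h \<Longrightarrow>
      thist comps s (s' # h)"

text \<open>Pure strategies of the interleaving (below state \<open>s\<close>), as 0/1 vectors over
  histories (lists of subsequent states): value 1 iff all player actions along it are played.\<close>
inductive ipure :: "tree list \<Rightarrow> state \<Rightarrow> (state list \<Rightarrow> real) \<Rightarrow> bool" for comps where
  tstop: "terminal_state comps s \<Longrightarrow> ipure comps s (\<lambda>h. if h = [] then 1 else 0)"
| obs: "\<not> terminal_state comps s \<Longrightarrow> has_obs comps s \<Longrightarrow>
      (\<forall>s' \<in> obs_succ comps s. ipure comps s' (F s')) \<Longrightarrow>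
      ipure comps s (\<lambda>h. case h of [] \<Rightarrow> 0
                       | s' # h' \<Rightarrow> if s' \<in> obs_succ comps s then F s' h' else 0)"
| dec: "\<not> terminal_state comps s \<Longrightarrow> \<not> has_obs comps s \<Longrightarrow> s' \<in> dec_succ comps s \<Longrightarrow>
      ipure comps s' x \<Longrightarrow>
      ipure comps s (\<lambda>h. case h of [] \<Rightarrow> 0 | s'' # h' \<Rightarrow> if s'' = s' then x h' else 0)"

definition reduced :: "tree list \<Rightarrow> (state \<Rightarrow> real) \<Rightarrow> bool" where
  "reduced comps q \<longleftrightarrow> (\<exists>m \<in> cohull (Collect (ipure comps (root_state comps))).
     q = (\<lambda>t. \<Sum>h \<in> {h. thist comps (root_state comps) h \<and> last (root_state comps # h) = t}.
              m h))"

definition phi_med :: "nat \<Rightarrow> tree \<Rightarrow> (state \<Rightarrow> real) \<Rightarrow> vec \<Rightarrow> vec" where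
  "phi_med k Y q y = (\<lambda>z. \<Sum>zs \<in> listset (replicate k (leaves Y)).
                          q (z # zs) * (\<Prod>i<k. y (zs ! i)))"

definition Phi_med :: "nat \<Rightarrow> tree \<Rightarrow> tree \<Rightarrow> (vec \<Rightarrow> vec) set" where
  "Phi_med k Y X = {phi_med k Y q | q. reduced (X # replicate k (dual Y)) q}"

text \<open>Multilinear utility of player \<open>i\<close> in an \<open>n\<close>-player game with tree-form strategy sets
  \<open>T j\<close>, given by its coefficient tensor \<open>U i\<close> over terminal-node profiles, evaluated at
  a profile of vectors.\<close>
definition util :: "nat \<Rightarrow> (nat \<Rightarrow> tree) \<Rightarrow> (nat \<Rightarrow> (nat \<Rightarrow> nat list) \<Rightarrow> real) \<Rightarrow> nat \<Rightarrow>
                    (nat \<Rightarrow> vec) \<Rightarrow> real" where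
  "util n T U i xs = (\<Sum>zs \<in> PiE {..<n} (\<lambda>j. leaves (T j)). U i zs * (\<Prod>j<n. xs j (zs j)))"

definition lin_swap_eq :: "nat \<Rightarrow> (nat \<Rightarrow> tree) \<Rightarrow> (nat \<Rightarrow> (nat \<Rightarrow> nat list) \<Rightarrow> real) \<Rightarrow>
                           (nat \<Rightarrow> vec) pmf \<Rightarrow> real \<Rightarrow> bool" where
  "lin_swap_eq n T U \<pi> \<epsilon> \<longleftrightarrow> (\<forall>i < n. \<forall>L. linear_fn L \<and> L ` strats (T i) \<subseteq> cohull (strats (T i)) \<longrightarrow>
      measure_pmf.expectation \<pi> (\<lambda>x. util n T U i (x(i := L (x i))))
        \<le> measure_pmf.expectation \<pi> (\<lambda>x. util n T U i x) + \<epsilon>)"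

definition gen_med_eq :: "nat \<Rightarrow> (nat \<Rightarrow> tree) \<Rightarrow> (nat \<Rightarrow> (nat \<Rightarrow> nat list) \<Rightarrow> real) \<Rightarrow> nat \<Rightarrow>
     (nat \<Rightarrow> tree) \<Rightarrow> (nat \<Rightarrow> vec \<Rightarrow> vec) \<Rightarrow> (nat \<Rightarrow> vec) pmf \<Rightarrow> real \<Rightarrow> bool" where
  "gen_med_eq n T U k Y \<phi> \<pi>' \<epsilon> \<longleftrightarrow> (\<forall>i < n. \<forall>\<phi>' \<in> Phi_med k (Y i) (T i).
      measure_pmf.expectation \<pi>' (\<lambda>y. util n T U i (\<lambda>j. if j = i then \<phi>' (y i) else \<phi> j (y j)))
        \<le> measure_pmf.expectation \<pi>' (\<lambda>y. util n T U i (\<lambda>j. \<phi> j (y j))) + \<epsilon>)"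

end

theory Submission
  imports Defs
begin

text \<open>Player \<open>i\<close>'s strategy is hidden behind additive secret sharing with \<open>k\<close> shares. The
  root of the new tree is an observation point with \<open>k\<close> copies of a share tree, so that a
  mediator has to spend one query per share. In a share tree each decision of the original tree is
  replaced by a share (the shares of all copies add up to the action played, modulo the number of
  actions), after which the environment claims an action, and the tree continues below the claimed
  action. At decision points the strategy does not reach, an arbitrary default strategy is shared.

  With one query per copy, a mediator learns all shares, adds them up, plays the resulting action
  and claims it in each copy: this deviation reconstructs the shared strategy. Conversely, let a
  mediator query a leaf in \<open>k\<close> copies. If some copy is not queried, then the answers are
  independent of the shared strategy. Otherwise, the expected product of the answers is a constant
  times the indicator that the strategy plays one specific action sequence (the sums of
  the shares, up to the first place where not all claims agree with the sum), which is linear. So every mediator deviation amounts in expectation to a linear map of the shared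
  strategy, and this map goes into the convex hull since the deviation does.\<close>

subsection \<open>Trees and pure strategies\<close>

text \<open>A copy sees only its own share, so it cannot know which action was played and in which
  subtree to continue; this is why the continuation is chosen by a claim. In \<open>Y\<close> the
  claim is an observation, so a share vector has to answer every claim, true or false. The default
  strategy supplies the answer below actions that are not played, and keeps fewer than
  \<open>k\<close> copies from showing whether a claim is true. False claims by the mediator must be
  harmless as well: the sharings below different claims are drawn independently, so expected
  products factor over the claims, and a factor that lacks one copy is constant by privacy.
  Linearity at a node therefore uses privacy at its children, and both are carried through one
  induction, in \<open>sharing\<close>. Two exactness requirements shape the rest. Reconstruction
  must be right on every sample, since the induced profile has to equal \<pi>. And the hypothesis on
  \<pi> speaks only about linear maps into the convex hull, so every mediator deviation has to be
  shown to send pure strategies into that hull.\<close>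

lemma nodeat_append:
  "nodeat t (p @ q) = (case nodeat t p of None \<Rightarrow> None | Some u \<Rightarrow> nodeat u q)"
  by (induction t p rule: nodeat.induct) auto

lemma is_dec_dual [simp]: "is_dec (dual t) = is_obs t"
  and is_obs_dual [simp]: "is_obs (dual t) = is_dec t"
  and children_dual [simp]: "children (dual t) = map dual (children t)"
  and dual_eq_Leaf [simp]: "dual t = Leaf \<longleftrightarrow> t = Leaf"
  by (cases t; simp)+

lemma nodeat_dual: "nodeat (dual t) p = map_option dual (nodeat t p)"
  by (induction t p rule: nodeat.induct) auto

lemma leaves_dual: "leaves (dual t) = leaves t"
  by (auto simp: leaves_def nodeat_dual)

lemma leaves_Leaf: "leaves Leaf = {[]}"
proof -
  have "nodeat Leaf p = Some Leaf \<longleftrightarrow> p = []" for p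
    by (cases p) auto
  then show ?thesis by (auto simp: leaves_def)
qed

lemma leaves_nonleaf:
  assumes "t \<noteq> Leaf"
  shows "leaves t = (\<Union>a<length (children t). Cons a ` leaves (children t ! a))"
proof -
  have "nodeat t p = Some Leaf \<longleftrightarrow>
      (\<exists>a q. p = a # q \<and> a < length (children t) \<and> nodeat (children t ! a) q = Some Leaf)" for p
    using assms by (cases p) auto
  then show ?thesis by (auto simp: leaves_def)
qed

lemma children_size: "a < length (children t) \<Longrightarrow> size (children t ! a) < size t"
  using size_list_estimation' [OF nth_mem, of a "children t" "size (children t ! a)" size]
  by (cases t) (simp_all add: less_Suc_eq_le)

lemma tree_children_induct [case_names child]:
  assumes "\<And>t. (\<And>a. a < length (children t) \<Longrightarrow> P (children t ! a)) \<Longrightarrow> P t"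
  shows "P t"
proof (induction t rule: measure_induct_rule [of size])
  case (less t)
  show ?case by (rule assms) (rule less, rule children_size)
qed

lemma finite_leaves: "finite (leaves t)"
proof (induction t rule: tree_children_induct)
  case (child t)
  then show ?case
    by (cases "t = Leaf") (auto simp: leaves_Leaf leaves_nonleaf)
qed

lemma wf_tree_nodeat:
  assumes "wf_tree t" "nodeat t p = Some u"
  shows "wf_tree u"
  unfolding wf_tree_def
proof (intro allI)
  fix q v
  show "nodeat u q = Some v \<longrightarrow> (v \<noteq> Leaf \<longrightarrow> children v \<noteq> []) \<and>
      (is_dec v \<longrightarrow> (\<forall>c \<in> set (children v). \<not> is_dec c)) \<and>
      (is_obs v \<longrightarrow> (\<forall>c \<in> set (children v). \<not> is_obs c))"
    using assms(1) [unfolded wf_tree_def, rule_format, of "p @ q" v] assms(2)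
    by (simp add: nodeat_append)
qed

lemma wf_tree_child: "wf_tree t \<Longrightarrow> a < length (children t) \<Longrightarrow> wf_tree (children t ! a)"
  by (rule wf_tree_nodeat [where p = "[a]"]) auto

lemma wf_treeI:
  assumes "t \<noteq> Leaf \<Longrightarrow> children t \<noteq> []"
    and "\<And>c. is_dec t \<Longrightarrow> c \<in> set (children t) \<Longrightarrow> \<not> is_dec c"
    and "\<And>c. is_obs t \<Longrightarrow> c \<in> set (children t) \<Longrightarrow> \<not> is_obs c"
    and "\<And>c. c \<in> set (children t) \<Longrightarrow> wf_tree c"
  shows "wf_tree t"
  unfolding wf_tree_def
proof (intro allI impI)
  fix p u assume p: "nodeat t p = Some u"
  show "(u \<noteq> Leaf \<longrightarrow> children u \<noteq> []) \<and>
    (is_dec u \<longrightarrow> (\<forall>c \<in> set (children u). \<not> is_dec c)) \<and>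
    (is_obs u \<longrightarrow> (\<forall>c \<in> set (children u). \<not> is_obs c))"
  proof (cases p)
    case Nil
    then have "u = t" using p by simp
    then show ?thesis using assms(1-3) by blast
  next
    case (Cons a q)
    then have a: "a < length (children t)" "nodeat (children t ! a) q = Some u"
      using p by (auto split: if_splits)
    then have "wf_tree (children t ! a)" using assms(4) nth_mem by blast
    then show ?thesis using a(2) unfolding wf_tree_def by blast
  qed
qed

lemma wf_tree_nonempty: "wf_tree t \<Longrightarrow> t \<noteq> Leaf \<Longrightarrow> children t \<noteq> []"
  using wf_tree_def [THEN iffD1, rule_format, of t "[]" t] by simp

lemma pure_strat_LeafE: "pure_strat Leaf x \<Longrightarrow> x = (\<lambda>p. if p = [] then 1 else 0)"
  by (erule pure_strat.cases) auto

lemma pure_strat_DecE: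
  assumes "pure_strat (Dec ts) x"
  obtains i x' where "i < length ts" "pure_strat (ts ! i) x'"
    "x = (\<lambda>p. case p of [] \<Rightarrow> 0 | a # q \<Rightarrow> if a = i then x' q else 0)"
  using assms by (cases rule: pure_strat.cases) auto

lemma pure_strat_ObsE:
  assumes "pure_strat (Obs ts) x"
  obtains xs where "\<And>i. i < length ts \<Longrightarrow> pure_strat (ts ! i) (xs i)"
    "x = (\<lambda>p. case p of [] \<Rightarrow> 0 | a # q \<Rightarrow> if a < length ts then xs a q else 0)"
  using assms by (cases rule: pure_strat.cases) auto

lemma strats_Leaf: "strats Leaf = {\<lambda>p. if p = [] then 1 else 0}"
proof
  show "strats Leaf \<subseteq> {\<lambda>p. if p = [] then 1 else 0}"
    unfolding strats_def by (blast dest: pure_strat_LeafE)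
  show "{\<lambda>p. if p = [] then 1 else 0} \<subseteq> strats Leaf"
    unfolding strats_def by (blast intro: pure_strat.leaf)
qed

lemma strats_Dec_iff:
  "x \<in> strats (Dec ts) \<longleftrightarrow> x [] = 0 \<and> (\<exists>i<length ts. (\<lambda>q. x (i # q)) \<in> strats (ts ! i) \<and>
     (\<forall>c q. c \<noteq> i \<longrightarrow> x (c # q) = 0))" (is "_ \<longleftrightarrow> ?R")
proof
  assume "x \<in> strats (Dec ts)"
  then have "pure_strat (Dec ts) x" by (simp add: strats_def)
  then show ?R
  proof (rule pure_strat_DecE)
    fix i x' assume "i < length ts" "pure_strat (ts ! i) x'"
      "x = (\<lambda>p. case p of [] \<Rightarrow> 0 | a # q \<Rightarrow> if a = i then x' q else 0)"
    then show ?R by (auto simp: strats_def)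
  qed
next
  assume ?R
  then obtain i where i: "x [] = 0" "i < length ts" "(\<lambda>q. x (i # q)) \<in> strats (ts ! i)"
    "\<And>c q. c \<noteq> i \<Longrightarrow> x (c # q) = 0" by auto
  then have "(\<lambda>p. case p of [] \<Rightarrow> 0 | a # q \<Rightarrow> if a = i then x (i # q) else 0) = x"
    by (auto simp: fun_eq_iff split: list.split)
  then show "x \<in> strats (Dec ts)"
    using pure_strat.dec [of i ts "\<lambda>q. x (i # q)"] i(2,3) by (simp add: strats_def)
qed

lemma strats_Obs_iff:
  "x \<in> strats (Obs ts) \<longleftrightarrow> x [] = 0 \<and> (\<forall>c<length ts. (\<lambda>q. x (c # q)) \<in> strats (ts ! c)) \<and>
     (\<forall>c q. c \<ge> length ts \<longrightarrow> x (c # q) = 0)" (is "_ \<longleftrightarrow> ?R")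
proof
  assume "x \<in> strats (Obs ts)"
  then have "pure_strat (Obs ts) x" by (simp add: strats_def)
  then show ?R
  proof (rule pure_strat_ObsE)
    fix xs assume "\<And>i. i < length ts \<Longrightarrow> pure_strat (ts ! i) (xs i)"
      "x = (\<lambda>p. case p of [] \<Rightarrow> 0 | a # q \<Rightarrow> if a < length ts then xs a q else 0)"
    then show ?R by (auto simp: strats_def)
  qed
next
  assume R: ?R
  then have "(\<lambda>p. case p of [] \<Rightarrow> 0 | a # q \<Rightarrow> if a < length ts then x (a # q) else 0) = x"
    by (auto simp: fun_eq_iff split: list.split)
  then show "x \<in> strats (Obs ts)"
    using pure_strat.obs [of ts "\<lambda>a q. x (a # q)"] R by (simp add: strats_def)
qed

text \<open>Well-formedness matters at observation points: \<open>Obs []\<close> has the zero vector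
  as a pure strategy. Nonzero leaves are how a played action is recognised from the vector
  alone.\<close>

lemma pure_strat_nonzero: "pure_strat t x \<Longrightarrow> wf_tree t \<Longrightarrow> \<exists>z. x z \<noteq> 0"
proof (induction rule: pure_strat.induct)
  case leaf
  show ?case by (rule exI [of _ "[]"]) simp
next
  case (dec i ts x)
  then obtain z where "x z \<noteq> 0" using wf_tree_child [of "Dec ts" i] by auto
  then show ?case by (intro exI [of _ "i # z"]) simp
next
  case (obs ts xs)
  then have n: "0 < length ts" using wf_tree_nonempty [of "Obs ts"] by auto
  then have "\<exists>z. xs 0 z \<noteq> 0"
    using obs wf_tree_child [of "Obs ts" 0] by simp
  then obtain z where "xs 0 z \<noteq> 0" ..
  then show ?case using n by (intro exI [of _ "0 # z"]) simp
qed

lemma pure_strat_ex: "wf_tree t \<Longrightarrow> \<exists>x. pure_strat t x"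
proof (induction t rule: tree_children_induct)
  case (child t)
  then have *: "\<exists>x. pure_strat (children t ! a) x" if "a < length (children t)" for a
    using that wf_tree_child by blast
  show ?case
  proof (cases t)
    case Leaf
    then show ?thesis using pure_strat.leaf by blast
  next
    case (Dec ts)
    then have "0 < length ts" using wf_tree_nonempty [of t] child.prems by auto
    moreover from this obtain x where "pure_strat (ts ! 0) x" using * [of 0] Dec by auto
    ultimately show ?thesis using Dec pure_strat.dec by blast
  next
    case (Obs ts)
    then have "\<forall>a<length ts. \<exists>x. pure_strat (ts ! a) x" using * by auto
    then obtain xs where "\<forall>a<length ts. pure_strat (ts ! a) (xs a)" by metis
    then show ?thesis using Obs pure_strat.obs by blast
  qed
qed

lemma finite_strats: "finite (strats t)"
proof (induction t rule: tree_children_induct)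
  case (child t)
  show ?case
  proof (cases t)
    case Leaf
    then show ?thesis by (simp add: strats_Leaf)
  next
    case (Dec ts)
    have "strats t \<subseteq> (\<Union>i<length ts.
        (\<lambda>x' p. case p of [] \<Rightarrow> 0 | a # q \<Rightarrow> if a = i then x' q else 0) ` strats (ts ! i))"
      using Dec by (auto simp: strats_def elim!: pure_strat_DecE)
    then show ?thesis by (rule finite_subset) (use child Dec in auto)
  next
    case (Obs ts)
    have "strats t \<subseteq>
        (\<lambda>xs p. case p of [] \<Rightarrow> 0 | a # q \<Rightarrow> if a < length ts then xs a q else 0) `
          PiE {..<length ts} (\<lambda>i. strats (ts ! i))"
    proof
      fix x assume "x \<in> strats t"
      then have "pure_strat (Obs ts) x" using Obs by (simp add: strats_def)
      then show "x \<in> (\<lambda>xs p. case p of [] \<Rightarrow> 0 | a # q \<Rightarrow> if a < length ts then xs a q else 0) `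
          PiE {..<length ts} (\<lambda>i. strats (ts ! i))"
      proof (rule pure_strat_ObsE)
        fix xs
        assume xs: "\<And>i. i < length ts \<Longrightarrow> pure_strat (ts ! i) (xs i)"
          "x = (\<lambda>p. case p of [] \<Rightarrow> 0 | a # q \<Rightarrow> if a < length ts then xs a q else 0)"
        show ?thesis
          by (rule image_eqI [where x = "restrict xs {..<length ts}"])
             (use xs in \<open>auto simp: strats_def fun_eq_iff split: list.split\<close>)
      qed
    qed
    then show ?thesis by (rule finite_subset) (use child Obs in \<open>auto intro!: finite_PiE\<close>)
  qed
qed

text \<open>At a decision point the child played by \<open>x\<close> contains a nonzero leaf, which
  forces \<open>x'\<close> to play the same child. So one inclusion of supports identifies a
  strategy, and decoding only has to rule out wrong leaves.\<close>

lemma pure_strat_eqI: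
  assumes "pure_strat t x" "pure_strat t x'" "wf_tree t" "\<And>z. x z \<noteq> 0 \<Longrightarrow> x' z \<noteq> 0"
  shows "x = x'"
  using assms
proof (induction t x arbitrary: x' rule: pure_strat.induct)
  case leaf
  then show ?case using pure_strat_LeafE by blast
next
  case (dec i ts x)
  from dec.prems(1) show ?case
  proof (rule pure_strat_DecE)
    fix i' y assume y: "i' < length ts" "pure_strat (ts ! i') y"
      "x' = (\<lambda>p. case p of [] \<Rightarrow> 0 | a # q \<Rightarrow> if a = i' then y q else 0)"
    have wf: "wf_tree (ts ! i)" using wf_tree_child [of "Dec ts" i] dec by auto
    have "i' = i" and sub: "y z \<noteq> 0" if "x z \<noteq> 0" for z
      using dec.prems(3) [of "i # z"] y(3) that by (auto split: if_splits)
    moreover obtain z where "x z \<noteq> 0" using pure_strat_nonzero dec.hyps wf by blast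
    ultimately have "i' = i" by blast
    moreover have "x = y"
      by (rule dec.IH) (use y wf sub \<open>i' = i\<close> in auto)
    ultimately show ?thesis unfolding y(3) by (auto simp: fun_eq_iff split: list.split)
  qed
next
  case (obs ts xs)
  from obs.prems(1) show ?case
  proof (rule pure_strat_ObsE)
    fix ys assume ys: "\<And>i. i < length ts \<Longrightarrow> pure_strat (ts ! i) (ys i)"
      "x' = (\<lambda>p. case p of [] \<Rightarrow> 0 | a # q \<Rightarrow> if a < length ts then ys a q else 0)"
    have "xs i = ys i" if "i < length ts" for i
    proof -
      have "ys i z \<noteq> 0" if "xs i z \<noteq> 0" for z
        using obs.prems(3) [of "i # z"] ys(2) that \<open>i < length ts\<close> by auto
      moreover have "wf_tree (ts ! i)" using wf_tree_child [of "Obs ts" i] obs \<open>i < length ts\<close> by auto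
      ultimately show ?thesis using obs.IH ys(1) that by blast
    qed
    then show ?thesis using ys(2) by (auto simp: fun_eq_iff split: list.split)
  qed
qed

subsection \<open>Convex hulls and linear functionals\<close>

text \<open>Weights extend by zero to all of \<open>A\<close>; this common index set lets convex
  combinations be merged termwise.\<close>

lemma cohull_finite_iff:
  assumes "finite A"
  shows "f \<in> cohull A \<longleftrightarrow>
    (\<exists>w. (\<forall>x\<in>A. 0 \<le> w x) \<and> sum w A = 1 \<and> f = (\<lambda>p. \<Sum>x\<in>A. w x * x p))" (is "_ \<longleftrightarrow> ?R")
proof
  assume "f \<in> cohull A"
  then obtain S w where S: "f = (\<lambda>p. \<Sum>x\<in>S. w x * x p)" "finite S" "S \<subseteq> A"
    "\<forall>x\<in>S. 0 \<le> w x" "sum w S = 1"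
    unfolding cohull_def by auto
  define w' where "w' = (\<lambda>x. if x \<in> S then w x else 0)"
  have 1: "sum w' A = 1"
    using S assms by (simp add: w'_def sum.inter_restrict [symmetric] Int_absorb1)
  have 2: "(\<Sum>x\<in>A. w' x * x p) = (\<Sum>x\<in>S. w x * x p)" for p
    by (rule sum.mono_neutral_cong_right) (use S assms in \<open>auto simp: w'_def\<close>)
  have "\<forall>x\<in>A. 0 \<le> w' x" using S by (auto simp: w'_def)
  then show ?R using 1 2 S(1) by (intro exI [of _ w']) auto
next
  assume ?R
  then obtain w where w: "\<forall>x\<in>A. 0 \<le> w x" "sum w A = 1" "f = (\<lambda>p. \<Sum>x\<in>A. w x * x p)" by auto
  then have "A \<noteq> {}" by auto
  then show "f \<in> cohull A" unfolding cohull_def mem_Collect_eq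
    using w assms by (intro exI [of _ A] exI [of _ w]) simp
qed

lemma cohull_convex:
  assumes "finite A" "finite I" "\<And>i. i \<in> I \<Longrightarrow> f i \<in> cohull A"
    "\<And>i. i \<in> I \<Longrightarrow> (0::real) \<le> v i" "sum v I = 1"
  shows "(\<lambda>p. \<Sum>i\<in>I. v i * f i p) \<in> cohull A"
proof -
  have "\<forall>i\<in>I. \<exists>w. (\<forall>x\<in>A. 0 \<le> w x) \<and> sum w A = 1 \<and> f i = (\<lambda>p. \<Sum>x\<in>A. w x * x p)"
    using assms(3) unfolding cohull_finite_iff [OF assms(1)] by (rule ballI)
  from bchoice [OF this] obtain W where W': "\<forall>i\<in>I. (\<forall>x\<in>A. 0 \<le> W i x) \<and> sum (W i) A = 1 \<and>
    f i = (\<lambda>p. \<Sum>x\<in>A. W i x * x p)" ..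
  have W: "(\<forall>x\<in>A. 0 \<le> W i x)" "sum (W i) A = 1" "f i p = (\<Sum>x\<in>A. W i x * x p)"
    if "i \<in> I" for i p
    using W' [rule_format, OF that] by simp_all
  define w where "w x = (\<Sum>i\<in>I. v i * W i x)" for x
  have "(\<Sum>x\<in>A. w x) = (\<Sum>i\<in>I. v i * (\<Sum>x\<in>A. W i x))"
    unfolding w_def by (subst sum.swap) (simp add: sum_distrib_left)
  also have "\<dots> = 1" using W(2) assms(5) by simp
  finally have 1: "sum w A = 1" .
  have "(\<Sum>i\<in>I. v i * f i p) = (\<Sum>x\<in>A. w x * x p)" for p
  proof -
    have "(\<Sum>i\<in>I. v i * f i p) = (\<Sum>i\<in>I. \<Sum>x\<in>A. v i * W i x * x p)"
      using W(3) by (simp add: sum_distrib_left mult.assoc)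
    also have "\<dots> = (\<Sum>x\<in>A. w x * x p)"
      unfolding w_def by (subst sum.swap) (simp add: sum_distrib_right)
    finally show ?thesis .
  qed
  moreover have "\<forall>x\<in>A. 0 \<le> w x"
    unfolding w_def using W(1) assms(4) by (auto intro!: sum_nonneg)
  ultimately show ?thesis unfolding cohull_finite_iff [OF assms(1)] using 1
    by (intro exI [of _ w]) simp
qed

lemma cohull_superset: "x \<in> A \<Longrightarrow> x \<in> cohull A"
  unfolding cohull_def mem_Collect_eq
  by (rule exI [of _ "{x}"], rule exI [of _ "\<lambda>_. 1"]) simp

text \<open>Agreement with a linear form is asked on pure strategies only. Hence constants qualify
  on well-formed trees, and functionals may take any value elsewhere, as the expectations over
  \<open>D x\<close> below do.\<close>

definition lin :: "tree \<Rightarrow> (vec \<Rightarrow> real) set" where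
  "lin t = {f. \<exists>c. \<forall>x\<in>strats t. f x = (\<Sum>w\<in>leaves t. c w * x w)}"

lemma lin_sum: "(\<And>i. i \<in> I \<Longrightarrow> f i \<in> lin t) \<Longrightarrow> (\<lambda>x. \<Sum>i\<in>I. a i * f i x) \<in> lin t"
proof -
  assume "\<And>i. i \<in> I \<Longrightarrow> f i \<in> lin t"
  then obtain c where c: "\<And>i x. i \<in> I \<Longrightarrow> x \<in> strats t \<Longrightarrow> f i x = (\<Sum>w\<in>leaves t. c i w * x w)"
    unfolding lin_def mem_Collect_eq by metis
  have "(\<Sum>i\<in>I. a i * f i x) = (\<Sum>w\<in>leaves t. (\<Sum>i\<in>I. a i * c i w) * x w)" if "x \<in> strats t" for x
  proof -
    have "(\<Sum>i\<in>I. a i * f i x) = (\<Sum>i\<in>I. \<Sum>w\<in>leaves t. a i * c i w * x w)"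
      using c that by (simp add: sum_distrib_left mult.assoc)
    also have "\<dots> = (\<Sum>w\<in>leaves t. (\<Sum>i\<in>I. a i * c i w) * x w)"
      by (subst sum.swap) (simp add: sum_distrib_right)
    finally show ?thesis .
  qed
  then show ?thesis unfolding lin_def mem_Collect_eq
    by (intro exI [of _ "\<lambda>w. \<Sum>i\<in>I. a i * c i w"]) simp
qed

lemma lin_cmult: "f \<in> lin t \<Longrightarrow> (\<lambda>x. a * f x) \<in> lin t"
  using lin_sum [of "{()}" "\<lambda>_. f" t "\<lambda>_. a"] by simp

lemma lin_cong: "f \<in> lin t \<Longrightarrow> (\<And>x. x \<in> strats t \<Longrightarrow> g x = f x) \<Longrightarrow> g \<in> lin t"
  unfolding lin_def by auto

text \<open>The coefficients of \<open>g\<close> are moved to the leaves below child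
  \<open>c\<close> and all others are zero; a strategy that does not enter \<open>c\<close> makes
  this form vanish by itself.\<close>

lemma lin_child:
  assumes g: "g \<in> lin (children t ! c)" and c: "c < length (children t)"
    and f: "\<And>x. x \<in> strats t \<Longrightarrow>
      (\<lambda>q. x (c # q)) \<in> strats (children t ! c) \<and> f x = g (\<lambda>q. x (c # q)) \<or>
      (\<forall>q. x (c # q) = 0) \<and> f x = 0"
  shows "f \<in> lin t"
proof -
  obtain d where d: "\<And>x. x \<in> strats (children t ! c) \<Longrightarrow>
      g x = (\<Sum>w\<in>leaves (children t ! c). d w * x w)"
    using g unfolding lin_def by auto
  define e where "e w = (if hd w = c then d (tl w) else 0)" for w
  have "t \<noteq> Leaf" using c by auto
  have "f x = (\<Sum>w\<in>leaves t. e w * x w)" if x: "x \<in> strats t" for x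
  proof -
    have "(\<Sum>w\<in>leaves t. e w * x w) = (\<Sum>w\<in>Cons c ` leaves (children t ! c). e w * x w)"
      by (rule sum.mono_neutral_right)
         (use c \<open>t \<noteq> Leaf\<close> finite_leaves [of t] in \<open>auto simp: leaves_nonleaf e_def\<close>)
    also have "\<dots> = (\<Sum>w\<in>leaves (children t ! c). d w * x (c # w))"
      by (subst sum.reindex) (auto simp: e_def)
    also have "\<dots> = f x" using f [OF x] d [of "\<lambda>q. x (c # q)"] by auto
    finally show ?thesis by simp
  qed
  then show ?thesis unfolding lin_def by blast
qed

text \<open>The root-to-leaf mass below a fixed choice at every observation point is constantly 1,
  so constants are restrictions of linear functionals.\<close>
lemma lin_const: "wf_tree t \<Longrightarrow> (\<lambda>_. a) \<in> lin t"
proof (induction t rule: tree_children_induct)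
  case (child t)
  have IH: "(\<lambda>_. a) \<in> lin (children t ! c)" if "c < length (children t)" for c
    using child.IH [OF that] wf_tree_child [OF child.prems that] by simp
  show ?case
  proof (cases t)
    case Leaf
    then show ?thesis unfolding lin_def
      by (intro CollectI exI [of _ "\<lambda>_. a"]) (simp add: leaves_Leaf strats_Leaf)
  next
    case (Obs ts)
    then have c: "0 < length (children t)" using wf_tree_nonempty [OF child.prems] by auto
    show ?thesis
      by (rule lin_child [OF IH [OF c] c]) (use c Obs in \<open>simp add: strats_Obs_iff\<close>)
  next
    case (Dec ts)
    \<comment> \<open>The indicator that action \<open>c\<close> is played, scaled by
      \<open>a\<close>, comes from a constant on child \<open>c\<close>. Exactly one of these
      indicators is active, so they add up to \<open>a\<close>.\<close>
    have *: "(\<lambda>x. if \<exists>q. x (c # q) \<noteq> 0 then a else 0) \<in> lin t" if c: "c < length ts" for c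
    proof (rule lin_child [where c = c and g = "\<lambda>_. a"])
      show "(\<lambda>_. a) \<in> lin (children t ! c)" "c < length (children t)" using IH c Dec by auto
      fix x assume "x \<in> strats t"
      then obtain i where i: "i < length ts" "(\<lambda>q. x (i # q)) \<in> strats (ts ! i)"
        "\<And>c q. c \<noteq> i \<Longrightarrow> x (c # q) = 0" using Dec by (auto simp: strats_Dec_iff)
      then have "\<exists>q. x (i # q) \<noteq> 0"
        using pure_strat_nonzero [of "ts ! i" "\<lambda>q. x (i # q)"]
          wf_tree_child [OF child.prems, of i] Dec by (auto simp: strats_def)
      then show "(\<lambda>q. x (c # q)) \<in> strats (children t ! c) \<and>
          (if \<exists>q. x (c # q) \<noteq> 0 then a else 0) = a \<or>
          (\<forall>q. x (c # q) = 0) \<and> (if \<exists>q. x (c # q) \<noteq> 0 then a else 0) = 0"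
        using i Dec by (cases "c = i") auto
    qed
    have "(\<lambda>x. \<Sum>c<length ts. 1 * (if \<exists>q. x (c # q) \<noteq> 0 then a else 0)) \<in> lin t"
      by (rule lin_sum) (use * in auto)
    then show ?thesis
    proof (rule lin_cong)
      fix x assume "x \<in> strats t"
      then obtain i where i: "i < length ts" "(\<lambda>q. x (i # q)) \<in> strats (ts ! i)"
        "\<And>c q. c \<noteq> i \<Longrightarrow> x (c # q) = 0" using Dec by (auto simp: strats_Dec_iff)
      then have "\<exists>q. x (i # q) \<noteq> 0"
        using pure_strat_nonzero [of "ts ! i" "\<lambda>q. x (i # q)"]
          wf_tree_child [OF child.prems, of i] Dec by (auto simp: strats_def)
      then have "(\<exists>q. x (c # q) \<noteq> 0) \<longleftrightarrow> c = i" for c using i(3) by auto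
      then show "a = (\<Sum>c<length ts. 1 * (if \<exists>q. x (c # q) \<noteq> 0 then a else 0))"
        using i(1) by simp
    qed
  qed
qed

subsection \<open>Histories of the interleaving\<close>

definition valid_state :: "tree list \<Rightarrow> state \<Rightarrow> bool" where
  "valid_state C s \<longleftrightarrow> length s = length C \<and> (\<forall>j<length C. nodeat (C ! j) (s ! j) \<noteq> None)"

lemma nodeat_cur:
  "valid_state C s \<Longrightarrow> j < length C \<Longrightarrow> nodeat (C ! j) (s ! j) = Some (cur C s j)"
  by (auto simp: valid_state_def cur_def)

lemma cur_eqI: "nodeat (C ! j) (s ! j) = Some u \<Longrightarrow> cur C s j = u"
  by (simp add: cur_def)

lemma nodeat_snoc:
  "nodeat t p = Some u \<Longrightarrow> a < length (children u) \<Longrightarrow> nodeat t (p @ [a]) = Some (children u ! a)"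
  by (simp add: nodeat_append)

lemma valid_root_state: "valid_state C (root_state C)"
  by (auto simp: valid_state_def root_state_def)

lemma obs_succ_component:
  assumes "valid_state C s" "s' \<in> obs_succ C s" "j < length C"
  shows "(if is_obs (cur C s j)
      then \<exists>a < length (children (cur C s j)). s' ! j = s ! j @ [a] \<and>
        nodeat (C ! j) (s' ! j) = Some (children (cur C s j) ! a)
      else s' ! j = s ! j \<and> nodeat (C ! j) (s' ! j) = Some (cur C s j))"
proof -
  have "length s = length C" using assms(1) by (simp add: valid_state_def)
  then have "if is_obs (cur C s j)
      then \<exists>a < length (children (cur C s j)). s' ! j = s ! j @ [a]
      else s' ! j = s ! j"
    using assms by (auto simp: obs_succ_def)
  moreover have "nodeat (C ! j) (s ! j) = Some (cur C s j)" by (rule nodeat_cur [OF assms(1,3)])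
  ultimately show ?thesis using nodeat_snoc by (auto split: if_splits)
qed

lemma succ_component:
  assumes "valid_state C s" "s' \<in> succ C s" "j < length C"
  shows "(s' ! j = s ! j \<and> nodeat (C ! j) (s' ! j) = Some (cur C s j)) \<or>
    (\<exists>a < length (children (cur C s j)). s' ! j = s ! j @ [a] \<and>
        nodeat (C ! j) (s' ! j) = Some (children (cur C s j) ! a))"
proof (cases "has_obs C s")
  case True
  then have "s' \<in> obs_succ C s" using assms by (simp add: succ_def)
  then show ?thesis using obs_succ_component [OF assms(1) _ assms(3), of s'] by (auto split: if_splits)
next
  case False
  then obtain i a where "s' = s[i := s ! i @ [a]]" "i < length s" "a < length (children (cur C s i))"
    using assms by (auto simp: succ_def dec_succ_def)
  then show ?thesis
    using nodeat_cur [OF assms(1,3)] nodeat_snoc [OF nodeat_cur [OF assms(1,3)]] assms(3)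
    by (cases "i = j") auto
qed

lemma length_succ: "s' \<in> succ C s \<Longrightarrow> length s' = length s"
  by (auto simp: succ_def obs_succ_def dec_succ_def split: if_splits)

lemma valid_succ: "valid_state C s \<Longrightarrow> s' \<in> succ C s \<Longrightarrow> valid_state C s'"
proof -
  assume v: "valid_state C s" and s': "s' \<in> succ C s"
  have "nodeat (C ! j) (s' ! j) \<noteq> None" if "j < length C" for j
    using succ_component [OF v s' that] by auto
  then show "valid_state C s'"
    using v length_succ [OF s'] by (simp add: valid_state_def)
qed

lemma succ_moves:
  assumes "valid_state C s" "s' \<in> succ C s"
  shows "\<exists>j<length C. s' ! j \<noteq> s ! j"
proof (cases "has_obs C s")
  case True
  then obtain j where "j < length s" "is_obs (cur C s j)" by (auto simp: has_obs_def)
  then show ?thesis using assms True by (force simp: succ_def obs_succ_def valid_state_def)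
next
  case False
  then show ?thesis using assms by (force simp: succ_def dec_succ_def valid_state_def)
qed

text \<open>The total size of the current subtrees drops with every move: no component moves up, and
  \<open>succ_moves\<close> gives one that moves down.\<close>

lemma state_induct [consumes 1, case_names state]:
  assumes "valid_state C s"
    and step: "\<And>s. valid_state C s \<Longrightarrow> (\<And>s'. s' \<in> succ C s \<Longrightarrow> P s') \<Longrightarrow> P s"
  shows "P s"
  using assms(1)
proof (induction "\<Sum>j<length C. size (cur C s j)" arbitrary: s rule: less_induct)
  case less
  show ?case
  proof (rule step [OF less.prems])
    fix s' assume s': "s' \<in> succ C s"
    have le: "size (cur C s' j) \<le> size (cur C s j)"
      and lt: "s' ! j \<noteq> s ! j \<Longrightarrow> size (cur C s' j) < size (cur C s j)" if "j < length C" for j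
      using succ_component [OF less.prems s' that] children_size [of _ "cur C s j"]
      by (auto dest!: cur_eqI simp: less_imp_le)
    obtain j where j: "j < length C" "s' ! j \<noteq> s ! j" using succ_moves [OF less.prems s'] by blast
    have "(\<Sum>j<length C. size (cur C s' j)) < (\<Sum>j<length C. size (cur C s j))"
      by (rule sum_strict_mono_ex1) (use le lt j in auto)
    then show "P s'" by (rule less.hyps) (rule valid_succ [OF less.prems s'])
  qed
qed

lemma finite_succ:
  assumes "valid_state C s"
  shows "finite (succ C s)"
proof (rule finite_subset)
  define A where "A = (\<Union>j<length C. insert (s ! j) ((\<lambda>a. s ! j @ [a]) ` {..<length (children (cur C s j))}))"
  show "finite {xs. set xs \<subseteq> A \<and> length xs = length C}"
    by (rule finite_lists_length_eq) (simp add: A_def)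
  show "succ C s \<subseteq> {xs. set xs \<subseteq> A \<and> length xs = length C}"
  proof
    fix s' assume s': "s' \<in> succ C s"
    have len: "length s' = length C" using length_succ [OF s'] assms by (simp add: valid_state_def)
    have "s' ! j \<in> A" if "j < length C" for j
      using succ_component [OF assms s' that] that by (auto simp: A_def)
    then show "s' \<in> {xs. set xs \<subseteq> A \<and> length xs = length C}"
      using len by (auto simp: in_set_conv_nth)
  qed
qed

section \<open>Terminal histories and their outcomes\<close>

lemma thist_terminal: "terminal_state C s \<Longrightarrow> {h. thist C s h} = {[]}"
  by (auto intro: thist.stop elim: thist.cases)

lemma thist_nonterminal:
  "\<not> terminal_state C s \<Longrightarrow> {h. thist C s h} = (\<Union>s'\<in>succ C s. Cons s' ` {h. thist C s' h})"
  by (auto intro: thist.step elim!: thist.cases [of C s])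

lemma finite_thist: "valid_state C s \<Longrightarrow> finite {h. thist C s h}"
proof (induction rule: state_induct)
  case (state s)
  then show ?case
    by (cases "terminal_state C s")
      (simp_all add: thist_terminal thist_nonterminal finite_succ)
qed

text \<open>Addresses only grow along a history; this prefix property later makes
  \<open>weight\<close> vanish on histories that contain a wrong move.\<close>

lemma thist_last:
  "thist C s h \<Longrightarrow> valid_state C s \<Longrightarrow> terminal_state C (last (s # h)) \<and> valid_state C (last (s # h)) \<and>
     (\<forall>j<length C. \<exists>q. last (s # h) ! j = s ! j @ q)"
proof (induction rule: thist.induct)
  case (stop s)
  then show ?case by simp
next
  case (step s s' h)
  have IH: "terminal_state C (last (s' # h)) \<and> valid_state C (last (s' # h)) \<and>
     (\<forall>j<length C. \<exists>q. last (s' # h) ! j = s' ! j @ q)"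
    using step valid_succ by blast
  have "\<exists>q. last (s' # h) ! j = s ! j @ q" if j: "j < length C" for j
  proof -
    obtain q where "last (s' # h) ! j = s' ! j @ q" using IH j by blast
    moreover have "\<exists>r. s' ! j = s ! j @ r" using succ_component [OF step.prems step.hyps(2) j] by auto
    ultimately show ?thesis by auto
  qed
  then show ?case using IH by simp
qed

text \<open>The reduced strategy of \<open>m\<close>, paired with a function of the terminal state.
  Starting at an arbitrary state lets the pairing be unfolded one move at a time.\<close>

definition outcome :: "tree list \<Rightarrow> state \<Rightarrow> (state list \<Rightarrow> real) \<Rightarrow> (state \<Rightarrow> real) \<Rightarrow> real" where
  "outcome C s m g = (\<Sum>h | thist C s h. m h * g (last (s # h)))"

lemma outcome_terminal: "terminal_state C s \<Longrightarrow> outcome C s m g = m [] * g s"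
  by (simp add: outcome_def thist_terminal)

lemma outcome_nonterminal:
  assumes "valid_state C s" "\<not> terminal_state C s"
  shows "outcome C s m g = (\<Sum>s'\<in>succ C s. outcome C s' (\<lambda>h. m (s' # h)) g)"
proof -
  have "outcome C s m g = (\<Sum>s'\<in>succ C s. \<Sum>h\<in>Cons s' ` {h. thist C s' h}. m h * g (last (s # h)))"
    unfolding outcome_def thist_nonterminal [OF assms(2)]
    by (rule sum.UNION_disjoint)
       (auto simp: finite_succ assms(1) finite_thist [OF valid_succ [OF assms(1)]])
  also have "\<dots> = (\<Sum>s'\<in>succ C s. outcome C s' (\<lambda>h. m (s' # h)) g)"
    unfolding outcome_def by (simp add: sum.reindex)
  finally show ?thesis .
qed

lemma outcome_eq_0:
  assumes "valid_state C s"
    "\<And>t. valid_state C t \<Longrightarrow> terminal_state C t \<Longrightarrow> (\<forall>j<length C. \<exists>q. t ! j = s ! j @ q) \<Longrightarrow> g t = 0"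
  shows "outcome C s m g = 0"
  unfolding outcome_def
  by (rule sum.neutral) (use assms thist_last in auto)

lemma outcome_0: "outcome C s (\<lambda>_. 0) g = 0"
  by (simp add: outcome_def)

lemma outcome_obs:
  assumes "valid_state C s" "\<not> terminal_state C s" "has_obs C s"
  shows "outcome C s (\<lambda>h. case h of [] \<Rightarrow> 0 | s' # h' \<Rightarrow> if s' \<in> obs_succ C s then F s' h' else 0) g
    = (\<Sum>s'\<in>obs_succ C s. outcome C s' (F s') g)"
  using assms by (simp add: outcome_nonterminal succ_def)

lemma outcome_dec:
  assumes "valid_state C s" "\<not> terminal_state C s" "\<not> has_obs C s" "s' \<in> dec_succ C s"
  shows "outcome C s (\<lambda>h. case h of [] \<Rightarrow> 0 | s'' # h' \<Rightarrow> if s'' = s' then x h' else 0) g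
    = outcome C s' x g"
proof -
  have "outcome C s (\<lambda>h. case h of [] \<Rightarrow> 0 | s'' # h' \<Rightarrow> if s'' = s' then x h' else 0) g
    = (\<Sum>s''\<in>dec_succ C s. if s'' = s' then outcome C s' x g else 0)"
    using assms by (auto simp: outcome_nonterminal succ_def outcome_0 intro!: sum.cong)
  also have "\<dots> = outcome C s' x g"
    using assms finite_succ [OF assms(1)] by (simp add: succ_def)
  finally show ?thesis .
qed

subsection \<open>Mediator deviations map into the convex hull\<close>

text \<open>As a function of the terminal state, this is the summand of \<open>phi_med\<close> at
  coordinate \<open>z\<close> with the factor \<open>q\<close> removed.\<close>

definition weight :: "nat \<Rightarrow> (nat \<Rightarrow> vec) \<Rightarrow> nat list \<Rightarrow> state \<Rightarrow> real" where
  "weight k ys z t = (if t ! 0 = z then 1 else 0) * (\<Prod>i<k. ys i (t ! Suc i))"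

text \<open>Fixing pure answers leaves only the observation points of \<open>X\<close> undetermined,
  so a pure mediator strategy played against them yields a pure strategy of \<open>X\<close>. The
  induction follows the interleaving: each \<open>ys i\<close> is a strategy below the current
  address of its component, and the outcomes over continuations of \<open>s ! 0\<close> form a
  strategy of the current subtree.\<close>

lemma outcome_ipure_strats:
  assumes C: "C = X # replicate k (dual Y)"
  shows "ipure C s m \<Longrightarrow> valid_state C s \<Longrightarrow>
    (\<And>i u. i < k \<Longrightarrow> nodeat Y (s ! Suc i) = Some u \<Longrightarrow> (\<lambda>q. ys i (s ! Suc i @ q)) \<in> strats u) \<Longrightarrow>
    nodeat X (s ! 0) = Some t \<Longrightarrow>
    (\<lambda>z. outcome C s m (weight k ys (s ! 0 @ z))) \<in> strats t"
proof (induction arbitrary: t rule: ipure.induct)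
  case (tstop s)
  have len: "length s = Suc k" using tstop.prems(1) C by (simp add: valid_state_def)
  have tl: "t = Leaf"
    using tstop.hyps tstop.prems(3) C len cur_eqI [of C 0 s t] by (auto simp: terminal_state_def)
  have "ys i (s ! Suc i) = 1" if i: "i < k" for i
  proof -
    have "nodeat (dual Y) (s ! Suc i) = Some (cur C s (Suc i))"
      using nodeat_cur [OF tstop.prems(1), of "Suc i"] i C by simp
    moreover have "cur C s (Suc i) = Leaf"
      using tstop.hyps i len by (simp add: terminal_state_def)
    ultimately have "nodeat Y (s ! Suc i) = Some Leaf" by (auto simp: nodeat_dual)
    from tstop.prems(2) [OF i this]
    have "(\<lambda>q. ys i (s ! Suc i @ q)) = (\<lambda>p. if p = [] then 1 else 0)"
      by (simp add: strats_Leaf)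
    from fun_cong [OF this, of "[]"] show ?thesis by simp
  qed
  then have "outcome C s (\<lambda>h. if h = [] then 1 else 0) (weight k ys (s ! 0 @ z)) =
      (if z = [] then 1 else 0)" for z
    by (simp add: outcome_terminal [OF tstop.hyps] weight_def)
  then show ?case by (simp add: tl strats_Leaf)
next
  case (dec s s' x)
  have len: "length s = Suc k" using dec.prems(1) C by (simp add: valid_state_def)
  have sc: "s' \<in> succ C s" using dec.hyps by (simp add: succ_def)
  note v' = valid_succ [OF dec.prems(1) sc]
  have eq: "outcome C s (\<lambda>h. case h of [] \<Rightarrow> 0 | s'' # h' \<Rightarrow> if s'' = s' then x h' else 0) g
    = outcome C s' x g" for g
    using outcome_dec dec.prems dec.hyps by blast
  obtain j a where j: "j < Suc k" "cur C s j \<noteq> Leaf" "a < length (children (cur C s j))"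
    "s' = s[j := s ! j @ [a]]"
    using dec.hyps(3) len by (auto simp: dec_succ_def)
  have no: "\<not> is_obs (cur C s j)" using dec.hyps(2) j(1) len by (auto simp: has_obs_def)
  show ?case
  proof (cases j)
    case 0
    have c0: "cur C s 0 = t" using cur_eqI [of C 0 s t] C dec.prems(3) by simp
    then obtain ts where t: "t = Dec ts" using no j(2) 0 by (cases t) auto
    have a: "a < length ts" using j(3) 0 c0 t by simp
    have s'0: "s' ! 0 = s ! 0 @ [a]" "\<And>i. s' ! Suc i = s ! Suc i" using j 0 len by auto
    have "nodeat X (s' ! 0) = Some (ts ! a)"
      unfolding s'0 using nodeat_snoc [OF dec.prems(3)] t a by simp
    then have "(\<lambda>z. outcome C s' x (weight k ys (s' ! 0 @ z))) \<in> strats (ts ! a)"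
      using dec.IH [OF v'] dec.prems(2) s'0(2) by simp
    moreover have off: "outcome C s' x (weight k ys (s ! 0 @ z)) = 0" if "\<And>q. z \<noteq> a # q" for z
    proof (rule outcome_eq_0 [OF v'])
      fix t assume "\<forall>j<length C. \<exists>q. t ! j = s' ! j @ q"
      then obtain q where "t ! 0 = s' ! 0 @ q" using C by auto
      then show "weight k ys (s ! 0 @ z) t = 0" using s'0 that [of q] by (simp add: weight_def)
    qed
    moreover have "outcome C s' x (weight k ys (s ! 0)) = 0" using off [of "[]"] by simp
    ultimately show ?thesis using a unfolding t strats_Dec_iff eq s'0 by auto
  next
    \<comment> \<open>A player move in a copy is an observation in \<open>Y\<close>:
      \<open>ys i\<close> is restricted to the observed child, while \<open>X\<close> stays where it
      is.\<close>
    case (Suc i)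
    then have i: "i < k" using j by simp
    have s'0: "s' ! 0 = s ! 0" "s' ! Suc i = s ! Suc i @ [a]" using j Suc len by auto
    have "nodeat (dual Y) (s ! Suc i) = Some (cur C s (Suc i))"
      using nodeat_cur [OF dec.prems(1), of "Suc i"] i C by simp
    then obtain u where u: "nodeat Y (s ! Suc i) = Some u" "cur C s (Suc i) = dual u"
      by (auto simp: nodeat_dual)
    then obtain us where us: "u = Obs us" using no j(2) Suc by (cases u) auto
    have a: "a < length us" using j(3) Suc u us by simp
    have nu: "nodeat Y (s ! Suc i @ [a]) = Some (us ! a)"
      using nodeat_snoc [OF u(1)] us a by simp
    have "(\<lambda>q. ys i' (s' ! Suc i' @ q)) \<in> strats v"
      if i': "i' < k" and v: "nodeat Y (s' ! Suc i') = Some v" for i' v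
    proof (cases "i' = i")
      case True
      have "(\<lambda>q. ys i (s ! Suc i @ q)) \<in> strats (Obs us)" using dec.prems(2) [OF i u(1)] us by simp
      then have "(\<lambda>q. ys i (s ! Suc i @ a # q)) \<in> strats (us ! a)" using a by (simp add: strats_Obs_iff)
      then show ?thesis using True s'0 nu v by simp
    next
      case False
      then have "s' ! Suc i' = s ! Suc i'" using j Suc by simp
      then show ?thesis using dec.prems(2) [OF i'] v by simp
    qed
    then show ?thesis
      unfolding eq using dec.IH [OF v'] dec.prems(3) s'0(1) by simp
  qed
next
  case (obs s F)
  note v = obs.prems(1)
  have len: "length s = Suc k" using v C by (simp add: valid_state_def)
  have eq: "outcome C s (\<lambda>h. case h of [] \<Rightarrow> 0 | s' # h' \<Rightarrow> if s' \<in> obs_succ C s then F s' h' else 0) g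
    = (\<Sum>s'\<in>obs_succ C s. outcome C s' (F s') g)" for g
    using outcome_obs obs.prems obs.hyps by blast
  have v': "valid_state C s'" if "s' \<in> obs_succ C s" for s'
    using valid_succ [OF v] that obs.hyps by (simp add: succ_def)
  have fin: "finite (obs_succ C s)" using finite_succ [OF v] obs.hyps by (simp add: succ_def)
  have c0: "cur C s 0 = t" using cur_eqI [of C 0 s t] C obs.prems(3) by simp
  define yt where "yt i = the (nodeat Y (s ! Suc i))" for i
  have yt: "nodeat Y (s ! Suc i) = Some (yt i)" "cur C s (Suc i) = dual (yt i)" if "i < k" for i
    using nodeat_cur [OF v, of "Suc i"] that C by (auto simp: nodeat_dual yt_def)
  \<comment> \<open>Observation points of the dual copy are decision points of \<open>Y\<close>,
    where \<open>ys i\<close> itself selects the branch, later named \<open>ch i\<close>.\<close>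
  have "\<exists>a. is_dec (yt i) \<longrightarrow> a < length (children (yt i)) \<and>
      (\<lambda>q. ys i (s ! Suc i @ a # q)) \<in> strats (children (yt i) ! a) \<and>
      (\<forall>c q. c \<noteq> a \<longrightarrow> ys i (s ! Suc i @ c # q) = 0)" if i: "i < k" for i
    using obs.prems(2) [OF i yt(1) [OF i]] by (cases "yt i") (auto simp: strats_Dec_iff)
  then obtain ch where ch: "\<And>i. i < k \<Longrightarrow> is_dec (yt i) \<Longrightarrow> ch i < length (children (yt i)) \<and>
      (\<lambda>q. ys i (s ! Suc i @ ch i # q)) \<in> strats (children (yt i) ! ch i) \<and>
      (\<forall>c q. c \<noteq> ch i \<longrightarrow> ys i (s ! Suc i @ c # q) = 0)" by metis
  \<comment> \<open>Given the observation \<open>a\<close> in \<open>X\<close>, this is the one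
    successor in which every copy follows its answers. Away from observation points of
    \<open>X\<close> all \<open>nxt a\<close> coincide.\<close>
  define nxt where "nxt a = (if is_obs t then s ! 0 @ [a] else s ! 0) #
      map (\<lambda>i. if is_dec (yt i) then s ! Suc i @ [ch i] else s ! Suc i) [0..<k]" for a
  have nxt_Suc: "nxt a ! Suc i = (if is_dec (yt i) then s ! Suc i @ [ch i] else s ! Suc i)"
    if "i < k" for a i using that by (simp add: nxt_def)
  have nxt_succ: "nxt a \<in> obs_succ C s" if "is_obs t \<Longrightarrow> a < length (children t)" for a
  proof -
    have "if is_obs (cur C s j)
      then (\<exists>b < length (children (cur C s j)). nxt a ! j = s ! j @ [b])
      else nxt a ! j = s ! j" if "j < Suc k" for j
    proof (cases j)
      case 0
      then show ?thesis using c0 \<open>is_obs t \<Longrightarrow> a < length (children t)\<close> by (simp add: nxt_def)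
    next
      case (Suc i)
      then show ?thesis using that yt(2) [of i] ch [of i] by (auto simp: nxt_Suc)
    qed
    moreover have "length (nxt a) = Suc k" by (simp add: nxt_def)
    ultimately show ?thesis unfolding obs_succ_def len by blast
  qed
  \<comment> \<open>Any other successor either contradicts the address \<open>z\<close> in
    \<open>X\<close> or enters a branch on which some \<open>ys i\<close> is zero.\<close>
  have off: "outcome C s' (F s') (weight k ys z) = 0"
    if s': "s' \<in> obs_succ C s" and ne: "s' \<noteq> nxt a" and z: "is_obs t \<Longrightarrow> \<exists>q. z = s ! 0 @ a # q" for s' a z
  proof (rule outcome_eq_0 [OF v' [OF s']])
    fix u assume u: "\<forall>j<length C. \<exists>q. u ! j = s' ! j @ q"
    have len': "length s' = Suc k" using s' len by (simp add: obs_succ_def)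
    obtain j where j: "j < Suc k" "s' ! j \<noteq> nxt a ! j"
      using ne len' nth_equalityI [of s' "nxt a"] by (auto simp: nxt_def)
    obtain q where q: "u ! j = s' ! j @ q" using u j(1) C by auto
    have sj: "if is_obs (cur C s j)
      then (\<exists>b < length (children (cur C s j)). s' ! j = s ! j @ [b])
      else s' ! j = s ! j" using s' j(1) len by (simp add: obs_succ_def)
    show "weight k ys z u = 0"
    proof (cases j)
      case 0
      then have "is_obs t" using j(2) sj c0 by (auto simp: nxt_def split: if_splits)
      then obtain b where b: "s' ! 0 = s ! 0 @ [b]" using sj 0 c0 by auto
      obtain r where "z = s ! 0 @ a # r" using z \<open>is_obs t\<close> by auto
      moreover have "b \<noteq> a" using b j(2) 0 \<open>is_obs t\<close> by (auto simp: nxt_def)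
      ultimately have "u ! 0 \<noteq> z" using q b 0 by simp
      then show ?thesis by (simp add: weight_def)
    next
      case (Suc i)
      then have i: "i < k" using j(1) by simp
      have d: "is_dec (yt i)" using j(2) sj yt(2) [OF i] i Suc by (auto simp: nxt_Suc split: if_splits)
      then obtain b where b: "s' ! Suc i = s ! Suc i @ [b]" using sj Suc yt(2) [OF i] by auto
      have "b \<noteq> ch i" using b j(2) Suc i d by (auto simp: nxt_Suc)
      then have "ys i (u ! Suc i) = 0" using q b Suc ch [OF i d] by simp
      then have "(\<Prod>i<k. ys i (u ! Suc i)) = 0" using i by auto
      then show ?thesis by (simp add: weight_def)
    qed
  qed
  have single: "(\<Sum>s'\<in>obs_succ C s. outcome C s' (F s') (weight k ys z)) =
      outcome C (nxt a) (F (nxt a)) (weight k ys z)"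
    if "is_obs t \<Longrightarrow> a < length (children t)" and z: "is_obs t \<Longrightarrow> \<exists>q. z = s ! 0 @ a # q" for a z
  proof -
    have "(\<Sum>s'\<in>obs_succ C s. outcome C s' (F s') (weight k ys z)) =
        (\<Sum>s'\<in>{nxt a}. outcome C s' (F s') (weight k ys z))"
      by (rule sum.mono_neutral_right) (use fin nxt_succ that off [OF _ _ z] in auto)
    then show ?thesis by simp
  qed
  have sub: "(\<lambda>z. outcome C (nxt a) (F (nxt a)) (weight k ys (nxt a ! 0 @ z))) \<in> strats t'"
    if a: "is_obs t \<Longrightarrow> a < length (children t)" and t': "nodeat X (nxt a ! 0) = Some t'" for a t'
  proof -
    have "(\<lambda>q. ys i (nxt a ! Suc i @ q)) \<in> strats u"
      if i: "i < k" and u: "nodeat Y (nxt a ! Suc i) = Some u" for i u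
    proof (cases "is_dec (yt i)")
      case True
      then have "u = children (yt i) ! ch i"
        using u nodeat_snoc [OF yt(1) [OF i], of "ch i"] ch [OF i True] i by (simp add: nxt_Suc)
      then show ?thesis using ch [OF i True] True i by (simp add: nxt_Suc)
    next
      case False
      then show ?thesis using u i obs.prems(2) [OF i] by (simp add: nxt_Suc)
    qed
    then show ?thesis
      using bspec [OF obs.IH nxt_succ [OF a]] v' [OF nxt_succ [OF a]] t' by blast
  qed
  show ?case
  proof (cases "is_obs t")
    case False
    then show ?thesis
      unfolding eq using single [of 0] sub [of 0 t] obs.prems(3) by (simp add: nxt_def)
  next
    case True
    then obtain ts where t: "t = Obs ts" by (cases t) auto
    \<comment> \<open>Addresses that enter no child of the observation point carry no mass under any
      successor; \<open>strats_Obs_iff\<close> asks for zero there.\<close>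
    have z0: "(\<Sum>s'\<in>obs_succ C s. outcome C s' (F s') (weight k ys (s ! 0 @ z))) = 0"
      if z: "\<And>b q. b < length ts \<Longrightarrow> z \<noteq> b # q" for z
    proof (rule sum.neutral, rule ballI, rule outcome_eq_0)
      fix s' u assume s': "s' \<in> obs_succ C s" and u: "\<forall>j<length C. \<exists>q. u ! j = s' ! j @ q"
      obtain b where "b < length ts" "s' ! 0 = s ! 0 @ [b]"
        using s' len c0 t by (auto simp: obs_succ_def dest!: spec [of _ 0])
      moreover obtain q where "u ! 0 = s' ! 0 @ q" using u C by auto
      ultimately have "u ! 0 \<noteq> s ! 0 @ z" using z [of b q] by auto
      then show "weight k ys (s ! 0 @ z) u = 0" by (simp add: weight_def)
    qed (rule v')
    have "(\<lambda>q. outcome C (nxt c) (F (nxt c)) (weight k ys (s ! 0 @ c # q))) \<in> strats (ts ! c)"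
      if c: "c < length ts" for c
    proof -
      have n0: "nxt c ! 0 = s ! 0 @ [c]" using True by (simp add: nxt_def)
      have "nodeat X (nxt c ! 0) = Some (ts ! c)"
        unfolding n0 using nodeat_snoc [OF obs.prems(3)] t c by simp
      then show ?thesis using sub [of c "ts ! c"] c t n0 by simp
    qed
    then show ?thesis
      unfolding t strats_Obs_iff eq using z0 z0 [of "[]"] single t by simp
  qed
qed

section \<open>Mediator deviations as outcomes\<close>

lemma in_listset_iff:
  "zs \<in> listset As \<longleftrightarrow> length zs = length As \<and> (\<forall>i<length As. zs ! i \<in> As ! i)"
proof (induction As arbitrary: zs)
  case (Cons A As)
  then show ?case
    by (cases zs) (auto simp: set_Cons_def nth_Cons' less_Suc_eq_0_disj)
qed auto

lemma finite_listset: "(\<And>A. A \<in> set As \<Longrightarrow> finite A) \<Longrightarrow> finite (listset As)"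
proof (induction As)
  case (Cons A As)
  have "set_Cons A (listset As) = (\<lambda>(x, xs). x # xs) ` (A \<times> listset As)"
    by (auto simp: set_Cons_def)
  then show ?case using Cons by simp
qed auto

text \<open>A terminal history ends in a single tuple, whose last \<open>k\<close> entries are
  leaves of \<open>Y\<close> because dualizing keeps the leaves. So once the sums over histories and
  over \<open>zs\<close> are exchanged, at most one \<open>zs\<close> contributes for each
  history.\<close>

lemma phi_med_eq_outcome:
  assumes C: "C = X # replicate k (dual Y)"
    and q: "q = (\<lambda>t. \<Sum>h \<in> {h. thist C (root_state C) h \<and> last (root_state C # h) = t}. m h)"
  shows "phi_med k Y q y = (\<lambda>z. outcome C (root_state C) m (weight k (\<lambda>_. y) z))"
proof
  fix z
  define H where "H = {h. thist C (root_state C) h}"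
  define L where "L = listset (replicate k (leaves Y))"
  let ?last = "\<lambda>h. last (root_state C # h)"
  have finH: "finite H" unfolding H_def by (rule finite_thist [OF valid_root_state])
  have finL: "finite L" unfolding L_def by (rule finite_listset) (auto simp: finite_leaves)
  have q': "q t = (\<Sum>h\<in>H. if ?last h = t then m h else 0)" for t
    unfolding q H_def using finH [unfolded H_def] by (subst sum.inter_filter [symmetric]) auto
  have "(\<Sum>zs\<in>L. (if ?last h = z # zs then m h else 0) * (\<Prod>i<k. y (zs ! i))) =
      m h * weight k (\<lambda>_. y) z (?last h)" if h: "h \<in> H" for h
  proof -
    from h have *: "terminal_state C (?last h) \<and> valid_state C (?last h)"
      using thist_last [OF _ valid_root_state] by (simp add: H_def)
    then have len: "length (?last h) = Suc k" using C by (simp add: valid_state_def)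
    then obtain z' zs' where l: "?last h = z' # zs'" "length zs' = k" by (cases "?last h") auto
    have "zs' ! i \<in> leaves Y" if "i < k" for i
    proof -
      have "nodeat (C ! Suc i) (?last h ! Suc i) = Some Leaf"
        using * nodeat_cur [of C "?last h" "Suc i"] that len C by (simp add: terminal_state_def)
      then show ?thesis using that l C leaves_dual [of Y] by (auto simp: leaves_def)
    qed
    then have "zs' \<in> L" using l by (simp add: L_def in_listset_iff)
    have "(\<Sum>zs\<in>L. (if ?last h = z # zs then m h else 0) * (\<Prod>i<k. y (zs ! i))) =
      (\<Sum>zs\<in>L. if zs = zs' then (if z' = z then m h * (\<Prod>i<k. y (zs ! i)) else 0) else 0)"
      unfolding l by (rule sum.cong) auto
    also have "\<dots> = m h * weight k (\<lambda>_. y) z (?last h)"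
      unfolding l using \<open>zs' \<in> L\<close> finL by (simp add: weight_def)
    finally show ?thesis .
  qed
  then have "(\<Sum>h\<in>H. \<Sum>zs\<in>L. (if ?last h = z # zs then m h else 0) * (\<Prod>i<k. y (zs ! i))) =
      outcome C (root_state C) m (weight k (\<lambda>_. y) z)"
    unfolding outcome_def H_def by (intro sum.cong) auto
  then show "phi_med k Y q y z = outcome C (root_state C) m (weight k (\<lambda>_. y) z)"
    unfolding phi_med_def L_def [symmetric] q' sum_distrib_right
    by (subst sum.swap) simp
qed

lemma outcome_root_strats:
  assumes C: "C = X # replicate k (dual Y)" and "ipure C (root_state C) m" "y \<in> strats Y"
  shows "(\<lambda>z. outcome C (root_state C) m (weight k (\<lambda>_. y) z)) \<in> strats X"
proof -
  have "root_state C ! 0 = []" "\<And>i. i < k \<Longrightarrow> root_state C ! Suc i = []"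
    using C by (simp_all add: root_state_def)
  then show ?thesis
    using outcome_ipure_strats [OF C assms(2) valid_root_state, of "\<lambda>_. y" X] assms(3) by fastforce
qed

text \<open>\<open>outcome\<close> is linear in the weighting of histories, so a mixed mediator
  strategy gives the corresponding mixture of the pure strategies from
  \<open>outcome_root_strats\<close>.\<close>

lemma phi_med_in_cohull:
  assumes "\<phi> \<in> Phi_med k Y X" "y \<in> strats Y"
  shows "\<phi> y \<in> cohull (strats X)"
proof -
  define C where "C = X # replicate k (dual Y)"
  from assms(1) obtain q where \<phi>: "\<phi> = phi_med k Y q" and "reduced C q"
    by (auto simp: Phi_med_def C_def)
  then obtain m where m: "m \<in> cohull (Collect (ipure C (root_state C)))"
    and q: "q = (\<lambda>t. \<Sum>h \<in> {h. thist C (root_state C) h \<and> last (root_state C # h) = t}. m h)"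
    by (auto simp: reduced_def)
  from m obtain S w where S: "finite S" "S \<subseteq> Collect (ipure C (root_state C))" "\<forall>x\<in>S. 0 \<le> w x"
    "sum w S = 1" and m_eq: "m = (\<lambda>p. \<Sum>x\<in>S. w x * x p)"
    unfolding cohull_def by auto
  have "\<phi> y = (\<lambda>z. \<Sum>x\<in>S. w x * outcome C (root_state C) x (weight k (\<lambda>_. y) z))"
    unfolding \<phi> phi_med_eq_outcome [OF C_def q] outcome_def m_eq sum_distrib_left sum_distrib_right
    by (subst sum.swap) (simp add: mult.assoc)
  also have "\<dots> \<in> cohull (strats X)"
    by (rule cohull_convex)
       (use S outcome_root_strats [OF C_def _ assms(2)] in
         \<open>auto intro!: finite_strats cohull_superset\<close>)
  finally show ?thesis .
qed

lemma ipure_phi_med: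
  assumes C: "C = X # replicate k (dual Y)" and "ipure C (root_state C) m"
  obtains \<phi> where "\<phi> \<in> Phi_med k Y X"
    "\<phi> = (\<lambda>y z. outcome C (root_state C) m (weight k (\<lambda>_. y) z))"
proof -
  define q where "q = (\<lambda>t. \<Sum>h \<in> {h. thist C (root_state C) h \<and> last (root_state C # h) = t}. m h)"
  have "reduced C q" unfolding reduced_def q_def
    using assms(2) by (intro bexI [of _ m] refl cohull_superset) simp
  then have "phi_med k Y q \<in> Phi_med k Y X" using C by (auto simp: Phi_med_def)
  moreover have "phi_med k Y q = (\<lambda>y z. outcome C (root_state C) m (weight k (\<lambda>_. y) z))"
    using phi_med_eq_outcome [OF C q_def] by auto
  ultimately show ?thesis using that by blast
qed

subsection \<open>Additive secret sharing of pure strategies\<close>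

text \<open>A tree for one share of a strategy: each decision is replaced by the choice of a share
  (its value modulo the number of actions), followed by an observation point at which the
  environment claims an action. A trivial decision in front of each observation point keeps
  the two kinds of nodes alternating.\<close>
primrec share_tree :: "tree \<Rightarrow> tree" where
  "share_tree Leaf = Leaf"
| "share_tree (Dec ts) = Dec (replicate (length ts) (Obs (map share_tree ts)))"
| "share_tree (Obs ts) = Dec [Obs (map share_tree ts)]"

text \<open>Observation points count as decisions with a single share value, so that both kinds of
  inner nodes are treated alike: there all shares are 0 and carry no information.\<close>

definition modulus :: "tree \<Rightarrow> nat" where
  "modulus t = (if is_dec t then length (children t) else 1)"

lemma share_tree_nonleaf:
  "t \<noteq> Leaf \<Longrightarrow> share_tree t = Dec (replicate (modulus t) (Obs (map share_tree (children t))))"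
  by (cases t) (simp_all add: modulus_def)

lemma not_is_obs_share_tree: "\<not> is_obs (share_tree t)"
  by (cases t) auto

lemma modulus_pos: "wf_tree t \<Longrightarrow> t \<noteq> Leaf \<Longrightarrow> modulus t > 0"
  using wf_tree_nonempty by (auto simp: modulus_def)

lemma wf_share_tree: "wf_tree t \<Longrightarrow> wf_tree (share_tree t)"
proof (induction t rule: tree_children_induct)
  case (child t)
  show ?case
  proof (cases "t = Leaf")
    case True
    then show ?thesis using child.prems by simp
  next
    case False
    have "wf_tree c" if "c \<in> set (map share_tree (children t))" for c
      using that child wf_tree_child [OF child.prems] by (auto simp: in_set_conv_nth)
    then have "wf_tree (Obs (map share_tree (children t)))"
      using wf_tree_nonempty [OF child.prems False] not_is_obs_share_tree
      by (intro wf_treeI [of "Obs (map share_tree (children t))"]) auto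
    then show ?thesis unfolding share_tree_nonleaf [OF False]
      using modulus_pos [OF child.prems False]
      by (intro wf_treeI [of "Dec (replicate n u)" for n u]) auto
  qed
qed

text \<open>The value 0 outside \<open>{..<k}\<close> makes the set finite, as the uniform
  distribution on it requires.\<close>

definition shares :: "nat \<Rightarrow> nat \<Rightarrow> nat \<Rightarrow> (nat \<Rightarrow> nat) set" where
  "shares k m a = {r \<in> PiE_dflt {..<k} 0 (\<lambda>_. {..<m}). (\<Sum>j<k. r j) mod m = a}"

lemma finite_shares: "finite (shares k m a)"
  unfolding shares_def by (rule finite_subset [OF _ finite_PiE_dflt [of "{..<k}"]]) auto

text \<open>Only the share \<open>j0\<close> is corrected, by \<open>b - a\<close> modulo
  \<open>m\<close>; the form \<open>m - a\<close> avoids truncated subtraction.\<close>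

lemma shares_shift:
  assumes "j0 < k" "a < m" "b < m"
  defines "f \<equiv> (\<lambda>r. r(j0 := (r j0 + (m - a) + b) mod m))"
  shows "r \<in> shares k m a \<Longrightarrow> f r \<in> shares k m b"
proof -
  assume r: "r \<in> shares k m a"
  have "m > 0" using assms by simp
  have S: "(\<Sum>j<k. g j) = g j0 + (\<Sum>j\<in>{..<k} - {j0}. g j)" for g :: "nat \<Rightarrow> nat"
    using assms(1) by (intro sum.remove) auto
  have "(\<Sum>j<k. f r j) mod m = ((r j0 + (m - a) + b) mod m + (\<Sum>j\<in>{..<k} - {j0}. r j)) mod m"
    unfolding S [of "f r"] by (simp add: f_def)
  also have "\<dots> = ((\<Sum>j<k. r j) + (m - a) + b) mod m"
    unfolding S [of r] by (simp add: mod_simps ac_simps)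
  also have "\<dots> = ((\<Sum>j<k. r j) mod m + (m - a) + b) mod m"
    by (metis mod_add_left_eq)
  also have "\<dots> = (a + (m - a) + b) mod m" using r by (simp add: shares_def)
  also have "\<dots> = b" using assms(2,3) by simp
  finally have "(\<Sum>j<k. f r j) mod m = b" .
  then show ?thesis using r \<open>m > 0\<close> assms(1) by (auto simp: shares_def PiE_dflt_def f_def)
qed

lemma shares_nonempty: "k \<ge> 1 \<Longrightarrow> a < m \<Longrightarrow> shares k m a \<noteq> {}"
proof -
  assume *: "k \<ge> 1" "a < m"
  \<comment> \<open>The witness puts the whole secret into share 0.\<close>
  have "(\<Sum>j<k. ((\<lambda>_. 0)(0 := a)) j) = (\<Sum>j<k. if j = 0 then a else 0)"
    by (rule sum.cong) auto
  also have "\<dots> = a" using * by simp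
  finally have "(\<lambda>_. 0)(0 := a) \<in> shares k m a"
    using * by (auto simp: shares_def PiE_dflt_def)
  then show ?thesis by blast
qed

text \<open>Correcting the share \<open>j0\<close> is a bijection between the sharings of
  \<open>a\<close> and those of \<open>b\<close> that leaves all other shares alone, so the uniform
  distributions agree once that share is forgotten.\<close>

lemma shares_private:
  assumes "j0 < k" "a < m" "b < m"
  shows "map_pmf (\<lambda>r. r(j0 := undefined)) (pmf_of_set (shares k m a)) =
    map_pmf (\<lambda>r. r(j0 := undefined)) (pmf_of_set (shares k m b))"
proof -
  define f where "f a b r = r(j0 := (r j0 + (m - a) + b) mod m)" for a b and r :: "nat \<Rightarrow> nat"
  have ff: "f b a (f a b r) = r" if r: "r \<in> shares k m a" and "a < m" "b < m" for a b r
  proof -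
    have "r j0 < m" using r assms(1) by (auto simp: shares_def PiE_dflt_def)
    have "((r j0 + (m - a) + b) mod m + (m - b) + a) mod m = (r j0 + (m - a) + b + (m - b) + a) mod m"
      by (metis mod_add_left_eq)
    also have "r j0 + (m - a) + b + (m - b) + a = r j0 + 2 * m" using that by simp
    finally show ?thesis using \<open>r j0 < m\<close> by (simp add: f_def)
  qed
  have mem: "f a b r \<in> shares k m b" if "r \<in> shares k m a" "a < m" "b < m" for a b r
    using shares_shift [OF assms(1) that(2,3,1)] by (simp add: f_def)
  have "f a b ` shares k m a = shares k m b"
    using mem [of _ a b] mem [of _ b a] ff [of _ b a] assms by (auto simp: image_iff) metis
  moreover have "inj_on (f a b) (shares k m a)"
    using ff [of _ a b] assms by (metis inj_on_inverseI)
  ultimately have "pmf_of_set (shares k m b) = map_pmf (f a b) (pmf_of_set (shares k m a))"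
    using shares_nonempty [of k a m] assms finite_shares by (subst map_pmf_of_set_inj) auto
  moreover have "(\<lambda>r. r(j0 := undefined)) \<circ> f a b = (\<lambda>r. r(j0 := undefined))"
    by (auto simp: f_def)
  ultimately show ?thesis by (simp add: map_pmf_compose [symmetric] pmf.map_comp)
qed

text \<open>An address in a share tree starts with a share and a claim. Copy \<open>j\<close> plays
  its own share and, after the claim \<open>c\<close>, continues with its part of the sharing made
  for child \<open>c\<close>.\<close>

definition encode :: "nat \<Rightarrow> (nat \<Rightarrow> nat) \<Rightarrow> (nat \<Rightarrow> nat \<Rightarrow> vec) \<Rightarrow> nat \<Rightarrow> vec" where
  "encode N r ys j = (\<lambda>p. case p of a # c # q \<Rightarrow> if a = r j \<and> c < N then ys c j q else 0 | _ \<Rightarrow> 0)"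

lemma encode_simps [simp]:
  "encode N r ys j [] = 0" "encode N r ys j [a] = 0"
  "encode N r ys j (a # c # q) = (if a = r j \<and> c < N then ys c j q else 0)"
  by (simp_all add: encode_def)

text \<open>The node shares and the sharings of all children are drawn independently; the product
  formula for expectations rests on this.\<close>

definition share_join :: "nat \<Rightarrow> (nat \<Rightarrow> nat) pmf \<Rightarrow> (nat \<Rightarrow> (nat \<Rightarrow> vec) pmf) \<Rightarrow> (nat \<Rightarrow> vec) pmf" where
  "share_join N R E = bind_pmf R (\<lambda>r. map_pmf (encode N r) (Pi_pmf {..<N} (\<lambda>_. undefined) E))"

lemma set_share_join:
  "ys' \<in> set_pmf (share_join N R E) \<Longrightarrow>
     \<exists>r\<in>set_pmf R. \<exists>ys. (\<forall>c<N. ys c \<in> set_pmf (E c)) \<and> ys' = encode N r ys"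
  by (auto simp: share_join_def set_Pi_pmf PiE_dflt_def)

lemma finite_share_join:
  "finite (set_pmf R) \<Longrightarrow> (\<And>c. c < N \<Longrightarrow> finite (set_pmf (E c))) \<Longrightarrow> finite (set_pmf (share_join N R E))"
  unfolding share_join_def by (auto simp: set_Pi_pmf intro!: finite_imageI finite_PiE_dflt)

text \<open>The vector of copy \<open>j\<close> depends only on the \<open>j\<close>-th share and
  the \<open>j\<close>-th parts of the child sharings, and no other copy reads these, so they can be
  erased first. The outer erasure remains on the right because \<open>encode\<close> still produces
  some value at \<open>j\<close>.\<close>

lemma share_join_forget:
  "map_pmf (\<lambda>ys. ys(j := undefined)) (share_join N R E) =
   map_pmf (\<lambda>ys. ys(j := undefined))
     (share_join N (map_pmf (\<lambda>r. r(j := undefined)) R) (\<lambda>c. map_pmf (\<lambda>ys. ys(j := undefined)) (E c)))"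
proof -
  have "Pi_pmf {..<N} (\<lambda>_. undefined) (\<lambda>c. map_pmf (\<lambda>ys. ys(j := undefined)) (E c)) =
     map_pmf (\<lambda>h. (\<lambda>ys. ys(j := undefined)) \<circ> h) (Pi_pmf {..<N} (\<lambda>_. undefined) E)"
    by (rule Pi_pmf_map) auto
  moreover have "(encode N (r(j := undefined)) ((\<lambda>ys. ys(j := undefined)) \<circ> ys))(j := undefined) =
      (encode N r ys)(j := undefined)" for r ys
    by (auto simp: fun_eq_iff encode_def split: list.split)
  ultimately show ?thesis
    by (simp add: share_join_def map_bind_pmf bind_map_pmf pmf.map_comp o_def)
qed

lemma share_join_private:
  assumes "map_pmf (\<lambda>r. r(j := undefined)) R = map_pmf (\<lambda>r. r(j := undefined)) R'"
    "\<And>c. c < N \<Longrightarrow> map_pmf (\<lambda>ys. ys(j := undefined)) (E c) = map_pmf (\<lambda>ys. ys(j := undefined)) (E' c)"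
  shows "map_pmf (\<lambda>ys. ys(j := undefined)) (share_join N R E) = map_pmf (\<lambda>ys. ys(j := undefined)) (share_join N R' E')"
proof -
  have "share_join N R0 (\<lambda>c. map_pmf (\<lambda>ys. ys(j := undefined)) (E c)) =
    share_join N R0 (\<lambda>c. map_pmf (\<lambda>ys. ys(j := undefined)) (E' c))" for R0
  proof -
    have "Pi_pmf {..<N} (\<lambda>_. undefined) (\<lambda>c. map_pmf (\<lambda>ys. ys(j := undefined)) (E c)) =
      Pi_pmf {..<N} (\<lambda>_. undefined) (\<lambda>c. map_pmf (\<lambda>ys. ys(j := undefined)) (E' c))"
      by (rule Pi_pmf_cong) (use assms(2) in simp_all)
    then show ?thesis by (simp add: share_join_def)
  qed
  then show ?thesis using assms(1) by (simp add: share_join_forget [of j N R] share_join_forget [of j N R'])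
qed

section \<open>Expected products of answers\<close>

lemma expectation_cong:
  fixes f g :: "'a \<Rightarrow> real"
  assumes "\<And>x. x \<in> set_pmf p \<Longrightarrow> f x = g x"
  shows "measure_pmf.expectation p f = measure_pmf.expectation p g"
  using assms by (intro integral_cong_AE) (auto simp: AE_measure_pmf_iff)

text \<open>The node shares decide whether every copy plays the prescribed share \<open>a j\<close>.
  The remaining factors are grouped by claim, and different claims read independent sharings.
  Nonnegativity serves the product rule for expectations over \<open>Pi_pmf\<close>.\<close>

lemma expectation_share_join:
  assumes fin: "finite (set_pmf R)" "\<And>c. c < N \<Longrightarrow> finite (set_pmf (E c))"
    and nn: "\<And>c ys j q. c < N \<Longrightarrow> ys \<in> set_pmf (E c) \<Longrightarrow> j < k \<Longrightarrow> ys j q \<ge> 0"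
    and c: "\<And>j. j < k \<Longrightarrow> c j < N"
  shows "measure_pmf.expectation (share_join N R E) (\<lambda>ys. \<Prod>j<k. ys j (a j # c j # w j)) =
    measure_pmf.prob R {r. \<forall>j<k. r j = a j} *
    (\<Prod>d<N. measure_pmf.expectation (E d) (\<lambda>ys. \<Prod>j\<in>{j. j < k \<and> c j = d}. ys j (w j)))"
proof -
  let ?G = "\<lambda>d ys. \<Prod>j\<in>{j. j < k \<and> c j = d}. ys j (w j)"
  define e where "e = (\<Prod>d<N. measure_pmf.expectation (E d) (?G d))"
  have "measure_pmf.expectation (map_pmf (encode N r) (Pi_pmf {..<N} (\<lambda>_. undefined) E))
      (\<lambda>ys. \<Prod>j<k. ys j (a j # c j # w j)) = indicator {r. \<forall>j<k. r j = a j} r * e" for r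
  proof -
    have "(\<Prod>j<k. ys (c j) j (w j)) = (\<Prod>d<N. ?G d (ys d))" for ys :: "nat \<Rightarrow> nat \<Rightarrow> vec"
    proof -
      have "(\<Prod>j<k. ys (c j) j (w j)) = (\<Prod>d<N. \<Prod>j\<in>{j\<in>{..<k}. c j = d}. ys (c j) j (w j))"
        by (rule prod.group [symmetric]) (use c in auto)
      also have "\<dots> = (\<Prod>d<N. ?G d (ys d))" by (auto intro!: prod.cong)
      finally show ?thesis .
    qed
    moreover have "(\<Prod>j<k. encode N r ys j (a j # c j # w j)) =
        indicator {r. \<forall>j<k. r j = a j} r * (\<Prod>j<k. ys (c j) j (w j))" for ys
    proof (cases "\<forall>j<k. r j = a j")
      case True
      then show ?thesis using c by (auto intro!: prod.cong)
    next
      case False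
      then obtain j where "j < k" "encode N r ys j (a j # c j # w j) = 0" by auto
      then have "(\<Prod>j<k. encode N r ys j (a j # c j # w j)) = 0" by (meson finite_lessThan lessThan_iff prod_zero)
      then show ?thesis using False by simp
    qed
    ultimately have "measure_pmf.expectation (map_pmf (encode N r) (Pi_pmf {..<N} (\<lambda>_. undefined) E))
      (\<lambda>ys. \<Prod>j<k. ys j (a j # c j # w j)) = indicator {r. \<forall>j<k. r j = a j} r *
        measure_pmf.expectation (Pi_pmf {..<N} (\<lambda>_. undefined) E) (\<lambda>ys. \<Prod>d<N. ?G d (ys d))"
      by simp
    also have "measure_pmf.expectation (Pi_pmf {..<N} (\<lambda>_. undefined) E) (\<lambda>ys. \<Prod>d<N. ?G d (ys d)) = e"
      unfolding e_def
      by (rule expectation_prod_Pi_pmf) (auto intro!: prod_nonneg nn integrable_measure_pmf_finite fin)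
    finally show ?thesis .
  qed
  then have "measure_pmf.expectation (share_join N R E) (\<lambda>ys. \<Prod>j<k. ys j (a j # c j # w j)) =
      (\<Sum>r\<in>set_pmf R. pmf R r * (indicator {r. \<forall>j<k. r j = a j} r * e))"
    unfolding share_join_def using fin
    by (subst pmf_expectation_bind [of "set_pmf R"]) (auto simp: set_Pi_pmf intro!: finite_imageI finite_PiE_dflt)
  also have "\<dots> = measure_pmf.expectation R (\<lambda>r. indicator {r. \<forall>j<k. r j = a j} r * e)"
    using fin(1) by (subst integral_measure_pmf [of "set_pmf R"]) auto
  also have "\<dots> = measure_pmf.prob R {r. \<forall>j<k. r j = a j} * e" by simp
  finally show ?thesis unfolding e_def .
qed

lemma strats_nonneg: "x \<in> strats t \<Longrightarrow> x q \<ge> 0"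
proof -
  have "pure_strat t x \<Longrightarrow> x q \<ge> 0" for t x q
    by (induction arbitrary: q rule: pure_strat.induct) (auto split: list.split)
  then show "x \<in> strats t \<Longrightarrow> x q \<ge> 0" by (simp add: strats_def)
qed

text \<open>A leaf \<open>w j\<close> of every share tree, all with the claims \<open>z\<close>, where moreover the shares add
  up to the decisions taken in \<open>z\<close>.\<close>
inductive aligned :: "nat \<Rightarrow> tree \<Rightarrow> nat list \<Rightarrow> (nat \<Rightarrow> nat list) \<Rightarrow> bool" for k where
  leaf: "aligned k Leaf [] w"
| node: "a < length (children t) \<Longrightarrow> (\<And>j. j < k \<Longrightarrow> w j = r j # a # w' j) \<Longrightarrow>
    (is_dec t \<Longrightarrow> (\<Sum>j<k. r j) mod length (children t) = a) \<Longrightarrow>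
    aligned k (children t ! a) z w' \<Longrightarrow> aligned k t (a # z) w"

text \<open>What the induction over the tree carries: finite support, validity of each copy, correct
  reconstruction, privacy of all copies but one, and linearity of expected products with one leaf
  from each copy. Reconstruction is one-sided (no wrong leaf); \<open>pure_strat_eqI\<close> later
  turns this into equality.\<close>

definition sharing :: "nat \<Rightarrow> tree \<Rightarrow> (vec \<Rightarrow> (nat \<Rightarrow> vec) pmf) \<Rightarrow> bool" where
  "sharing k t D \<longleftrightarrow>
    (\<forall>x\<in>strats t. finite (set_pmf (D x))) \<and>
    (\<forall>x\<in>strats t. \<forall>ys\<in>set_pmf (D x). \<forall>j<k. ys j \<in> strats (share_tree t)) \<and>
    (\<forall>x\<in>strats t. \<forall>ys\<in>set_pmf (D x). \<forall>z w. aligned k t z w \<longrightarrow>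
      (\<forall>j<k. ys j (w j) \<noteq> 0) \<longrightarrow> x z \<noteq> 0) \<and>
    (\<forall>x\<in>strats t. \<forall>x'\<in>strats t. \<forall>j<k.
      map_pmf (\<lambda>ys. ys(j := undefined)) (D x) = map_pmf (\<lambda>ys. ys(j := undefined)) (D x')) \<and>
    (\<forall>w. (\<forall>j<k. w j \<in> leaves (share_tree t)) \<longrightarrow>
      (\<lambda>x. measure_pmf.expectation (D x) (\<lambda>ys. \<Prod>j<k. ys j (w j))) \<in> lin t)"

lemma sharingD:
  assumes "sharing k t D"
  shows "x \<in> strats t \<Longrightarrow> finite (set_pmf (D x))"
    and "x \<in> strats t \<Longrightarrow> ys \<in> set_pmf (D x) \<Longrightarrow> j < k \<Longrightarrow> ys j \<in> strats (share_tree t)"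
    and "x \<in> strats t \<Longrightarrow> ys \<in> set_pmf (D x) \<Longrightarrow> aligned k t z w \<Longrightarrow>
      (\<And>j. j < k \<Longrightarrow> ys j (w j) \<noteq> 0) \<Longrightarrow> x z \<noteq> 0"
    and "x \<in> strats t \<Longrightarrow> x' \<in> strats t \<Longrightarrow> j < k \<Longrightarrow>
      map_pmf (\<lambda>ys. ys(j := undefined)) (D x) = map_pmf (\<lambda>ys. ys(j := undefined)) (D x')"
    and "(\<And>j. j < k \<Longrightarrow> w j \<in> leaves (share_tree t)) \<Longrightarrow>
      (\<lambda>x. measure_pmf.expectation (D x) (\<lambda>ys. \<Prod>j<k. ys j (w j))) \<in> lin t"
  using assms unfolding sharing_def by blast+

lemma sharing_expectation_eq:
  fixes h :: "(nat \<Rightarrow> vec) \<Rightarrow> real"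
  assumes "sharing k t D" "x \<in> strats t" "x' \<in> strats t" "j < k"
    and h: "\<And>ys. h (ys(j := undefined)) = h ys"
  shows "measure_pmf.expectation (D x) h = measure_pmf.expectation (D x') h"
proof -
  have *: "measure_pmf.expectation (D x) h =
    measure_pmf.expectation (map_pmf (\<lambda>ys. ys(j := undefined)) (D x)) h" for x
    by (simp add: h)
  show ?thesis unfolding * [of x] * [of x'] sharingD(4) [OF assms(1-4)] by (rule refl)
qed

text \<open>Prescribing the shares of all copies leaves at most one vector, and it is a sharing of
  \<open>b\<close> exactly if its entries add up to \<open>b\<close>; the distribution being
  uniform, this gives the probability.\<close>

lemma prob_shares:
  assumes "k \<ge> 1" "b < m" "\<And>j. j < k \<Longrightarrow> a j < m"
  shows "measure_pmf.prob (pmf_of_set (shares k m b)) {r. \<forall>j<k. r j = a j} =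
    (if (\<Sum>j<k. a j) mod m = b then 1 / card (shares k m b) else 0)"
proof -
  let ?a = "\<lambda>j. if j < k then a j else 0"
  have S: "(\<Sum>j<k. ?a j) = (\<Sum>j<k. a j)" by (rule sum.cong) auto
  have "shares k m b \<inter> {r. \<forall>j<k. r j = a j} =
      (if (\<Sum>j<k. a j) mod m = b then {?a} else {})"
  proof -
    have "r = ?a" if "r \<in> shares k m b" "\<forall>j<k. r j = a j" for r
      using that by (auto simp: shares_def PiE_dflt_def)
    moreover have "?a \<in> shares k m b \<longleftrightarrow> (\<Sum>j<k. a j) mod m = b"
      using assms(3) by (auto simp: shares_def PiE_dflt_def S)
    ultimately show ?thesis by auto
  qed
  then show ?thesis
    using shares_nonempty [OF assms(1,2)] finite_shares by (simp add: measure_pmf_of_set)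
qed

text \<open>\<open>D\<close> shares the action at the node and, independently, one strategy for
  every child: the restriction of \<open>x\<close> where that is a strategy, the fixed default
  elsewhere. An expected product then depends on the action and on a functional at one child, which
  \<open>lin_child\<close> lifts.\<close>

lemma sharing_node:
  assumes k: "k \<ge> 1" and wf: "wf_tree t" and nl: "t \<noteq> Leaf"
    and Dc: "\<And>c. c < length (children t) \<Longrightarrow> sharing k (children t ! c) (Dc c)"
  shows "\<exists>D. sharing k t D"
proof -
  define N where "N = length (children t)"
  define ch where "ch c = children t ! c" for c
  define m where "m = modulus t"
  note Dc = Dc [folded N_def ch_def]
  have wfc: "wf_tree (ch c)" if "c < N" for c using wf_tree_child [OF wf] that by (simp add: N_def ch_def)
  have "N > 0" using wf_tree_nonempty [OF wf nl] by (simp add: N_def)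
  have "m > 0" using modulus_pos [OF wf nl] by (simp add: m_def)
  have "\<exists>x. x \<in> strats (ch c)" if "c < N" for c
    using pure_strat_ex [OF wfc [OF that]] by (simp add: strats_def)
  then obtain dflt where dflt: "\<And>c. c < N \<Longrightarrow> dflt c \<in> strats (ch c)" by metis
  define sub where
    "sub x c = (if (\<lambda>q. x (c # q)) \<in> strats (ch c) then (\<lambda>q. x (c # q)) else dflt c)" for x :: vec and c
  have sub: "sub x c \<in> strats (ch c)" if "c < N" for x c
    using dflt that by (simp add: sub_def)
  \<comment> \<open>An action that is not played leaves the zero vector below it, which is no
    strategy, so \<open>sub\<close> uses the default exactly there.\<close>
  have zero: "(\<lambda>q. x (c # q)) \<notin> strats (ch c)" if "c < N" "\<And>q. x (c # q) = 0" for x :: vec and c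
    using pure_strat_nonzero [OF _ wfc [OF that(1)]] that(2) by (force simp: strats_def)
  \<comment> \<open>The value that gets shared: the action played at a decision point, and 0 at an
    observation point, where \<open>m\<close> is 1.\<close>
  have "\<exists>i<m. if is_dec t then (\<lambda>q. x (i # q)) \<in> strats (ch i) \<and> (\<forall>c q. c \<noteq> i \<longrightarrow> x (c # q) = 0)
      else (\<forall>c<N. (\<lambda>q. x (c # q)) \<in> strats (ch c))" if "x \<in> strats t" for x
    using that nl \<open>m > 0\<close>
    by (cases t) (auto simp: strats_Dec_iff strats_Obs_iff m_def modulus_def ch_def N_def)
  then obtain act where act: "\<And>x. x \<in> strats t \<Longrightarrow> act x < m"
    and act': "\<And>x. x \<in> strats t \<Longrightarrow> if is_dec t then (\<lambda>q. x (act x # q)) \<in> strats (ch (act x)) \<and>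
        (\<forall>c q. c \<noteq> act x \<longrightarrow> x (c # q) = 0)
      else (\<forall>c<N. (\<lambda>q. x (c # q)) \<in> strats (ch c))"
    by metis
  have m_dec: "is_dec t \<Longrightarrow> m = N" and m_obs: "\<not> is_dec t \<Longrightarrow> m = 1"
    by (simp_all add: m_def N_def modulus_def)
  have sub_played: "sub x c = (\<lambda>q. x (c # q))" if "x \<in> strats t" "c < N" "is_dec t \<Longrightarrow> c = act x" for x c
    using act' [OF that(1)] that(2,3) by (cases "is_dec t") (auto simp: sub_def)
  have sub_unplayed: "sub x c = dflt c" if "x \<in> strats t" "c < N" "is_dec t" "c \<noteq> act x" for x c
    using act' [OF that(1)] zero [OF that(2), of x] that(3,4) by (auto simp: sub_def)
  define R where "R x = pmf_of_set (shares k m (act x))" for x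
  define D where "D x = share_join N (R x) (\<lambda>c. Dc c (sub x c))" for x
  have set_R: "set_pmf (R x) = shares k m (act x)" if "x \<in> strats t" for x
    unfolding R_def using shares_nonempty [OF k act [OF that]] finite_shares by (rule set_pmf_of_set)
  have fin: "finite (set_pmf (Dc c (sub x c)))" if "c < N" for c x
    by (rule sharingD(1) [OF Dc [OF that] sub [OF that]])
  have finR: "finite (set_pmf (R x))" if "x \<in> strats t" for x
    using set_R [OF that] finite_shares by simp
  have tree: "share_tree t = Dec (replicate m (Obs (map share_tree (children t))))"
    unfolding m_def by (rule share_tree_nonleaf [OF nl])
  have supp: "\<exists>r\<in>shares k m (act x). \<exists>ys. (\<forall>c<N. ys c \<in> set_pmf (Dc c (sub x c))) \<and>
      ys' = encode N r ys" if "x \<in> strats t" "ys' \<in> set_pmf (D x)" for x ys'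
    using set_share_join [OF that(2) [unfolded D_def]] set_R [OF that(1)] by simp
  have strat: "ys' j \<in> strats (share_tree t)" if x: "x \<in> strats t" "ys' \<in> set_pmf (D x)" "j < k" for x ys' j
  proof -
    obtain r ys where r: "r \<in> shares k m (act x)" and ys: "\<And>c. c < N \<Longrightarrow> ys c \<in> set_pmf (Dc c (sub x c))"
      and eq: "ys' = encode N r ys" using supp [OF x(1,2)] by blast
    have "r j < m" using r x(3) by (auto simp: shares_def PiE_dflt_def)
    have "ys c j \<in> strats (share_tree (ch c))" if "c < N" for c
      by (rule sharingD(2) [OF Dc [OF that] sub [OF that] ys [OF that] x(3)])
    then have "(\<lambda>q. encode N r ys j (r j # q)) \<in> strats (Obs (map share_tree (children t)))"
      by (auto simp: strats_Obs_iff N_def ch_def)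
    moreover have "encode N r ys j (a # q) = 0" if "a \<noteq> r j" for a q
      using that by (cases q) auto
    ultimately show ?thesis
      using \<open>r j < m\<close> unfolding tree strats_Dec_iff eq by auto
  qed
  have decode: "x z \<noteq> 0"
    if x: "x \<in> strats t" "ys' \<in> set_pmf (D x)" and al: "aligned k t z w"
      and nz: "\<And>j. j < k \<Longrightarrow> ys' j (w j) \<noteq> 0" for x ys' z w
    using al
  proof cases
    case leaf
    then show ?thesis using nl by simp
  next
    case (node a r' w' z')
    obtain r ys where r: "r \<in> shares k m (act x)" and ys: "\<And>c. c < N \<Longrightarrow> ys c \<in> set_pmf (Dc c (sub x c))"
      and eq: "ys' = encode N r ys" using supp [OF x] by blast
    have a: "a < N" using node by (simp add: N_def)
    have rr: "r' j = r j" "ys a j (w' j) \<noteq> 0" if "j < k" for j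
      using nz [OF that] node(3) [OF that] by (auto simp: eq split: if_splits)
    have "sub x a z' \<noteq> 0"
      by (rule sharingD(3) [OF Dc [OF a] sub [OF a] ys [OF a]]) (use node rr in \<open>auto simp: ch_def\<close>)
    moreover have "a = act x" if "is_dec t"
    proof -
      have "a = (\<Sum>j<k. r j) mod m"
        using node(4) [OF that] rr(1) m_dec [OF that] by (simp add: N_def)
      then show ?thesis using r by (simp add: shares_def)
    qed
    ultimately show ?thesis using sub_played [OF x(1) a] node(1) by simp
  qed
  have priv: "map_pmf (\<lambda>ys. ys(j := undefined)) (D x) = map_pmf (\<lambda>ys. ys(j := undefined)) (D x')"
    if "x \<in> strats t" "x' \<in> strats t" "j < k" for x x' j
    unfolding D_def
  proof (rule share_join_private)
    show "map_pmf (\<lambda>r. r(j := undefined)) (R x) = map_pmf (\<lambda>r. r(j := undefined)) (R x')"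
      unfolding R_def by (rule shares_private) (use that act in auto)
    show "map_pmf (\<lambda>ys. ys(j := undefined)) (Dc c (sub x c)) =
        map_pmf (\<lambda>ys. ys(j := undefined)) (Dc c (sub x' c))" if "c < N" for c
      by (rule sharingD(4) [OF Dc [OF that] sub [OF that] sub [OF that] \<open>j < k\<close>])
  qed
  have linear: "(\<lambda>x. measure_pmf.expectation (D x) (\<lambda>ys. \<Prod>j<k. ys j (w j))) \<in> lin t"
    if w: "\<And>j. j < k \<Longrightarrow> w j \<in> leaves (share_tree t)" for w
  proof -
    have "\<exists>a c v. w j = a # c # v \<and> a < m \<and> c < N \<and> v \<in> leaves (share_tree (ch c))" if "j < k" for j
      using w [OF that] by (auto simp: tree leaves_nonleaf N_def ch_def)
    then obtain a c v where w_eq: "\<And>j. j < k \<Longrightarrow> w j = a j # c j # v j" and a: "\<And>j. j < k \<Longrightarrow> a j < m"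
      and c: "\<And>j. j < k \<Longrightarrow> c j < N" and v: "\<And>j. j < k \<Longrightarrow> v j \<in> leaves (share_tree (ch (c j)))"
      by metis
    define \<sigma> where "\<sigma> = (\<Sum>j<k. a j) mod m"
    have "\<sigma> < m" using \<open>m > 0\<close> by (simp add: \<sigma>_def)
    define \<kappa> where "\<kappa> = 1 / real (card (shares k m \<sigma>))"
    define h :: "nat \<Rightarrow> (nat \<Rightarrow> vec) \<Rightarrow> real" where "h d ys = (\<Prod>j\<in>{j. j < k \<and> c j = d}. ys j (v j))" for d ys
    \<comment> \<open>The product over all claims depends on \<open>x\<close> through at most one
      child \<open>e\<close>.\<close>
    have "\<exists>e<N. \<exists>g\<in>lin (ch e). \<forall>x\<in>strats t.
        (\<Prod>d<N. measure_pmf.expectation (Dc d (sub x d)) (h d)) = g (sub x e)"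
    proof (cases "\<forall>j<k. c j = c 0")
      case True
      define e where "e = c 0"
      have e: "e < N" using c [of 0] k by (simp add: e_def)
      have ce: "c j = e" if "j < k" for j using True that unfolding e_def by blast
      have h: "h d = (if d = e then (\<lambda>ys. \<Prod>j<k. ys j (v j)) else (\<lambda>_. 1))" for d
      proof -
        have "{j. j < k \<and> c j = d} = (if d = e then {..<k} else {})" using ce by auto
        then show ?thesis by (auto simp: h_def fun_eq_iff)
      qed
      have "(\<Prod>d<N. measure_pmf.expectation (Dc d (sub x d)) (h d)) =
        (\<Prod>d<N. if d = e then measure_pmf.expectation (Dc e (sub x e)) (\<lambda>ys. \<Prod>j<k. ys j (v j)) else 1)" for x
        by (rule prod.cong) (auto simp: h)
      then have "(\<Prod>d<N. measure_pmf.expectation (Dc d (sub x d)) (h d)) =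
         measure_pmf.expectation (Dc e (sub x e)) (\<lambda>ys. \<Prod>j<k. ys j (v j))" for x
        using e by simp
      moreover have "(\<lambda>x. measure_pmf.expectation (Dc e x) (\<lambda>ys. \<Prod>j<k. ys j (v j))) \<in> lin (ch e)"
        by (rule sharingD(5) [OF Dc [OF e]]) (use v ce in simp)
      ultimately show ?thesis using e
        by (intro exI [of _ e] conjI bexI [where x = "\<lambda>x. measure_pmf.expectation (Dc e x) (\<lambda>ys. \<Prod>j<k. ys j (v j))"])
           auto
    next
      case False
      \<comment> \<open>The claims differ, so for every \<open>d\<close> some copy claims something
        else; the factor of \<open>d\<close> lacks that copy and is constant by privacy. Child 0
        then stands in for \<open>e\<close>, with a constant \<open>g\<close>.\<close>
      have "measure_pmf.expectation (Dc d (sub x d)) (h d) =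
          measure_pmf.expectation (Dc d (dflt d)) (h d)" if d: "d < N" for d x
      proof -
        obtain j0 where j0: "j0 < k" "c j0 \<noteq> d" using False k by fastforce
        show ?thesis
          by (rule sharing_expectation_eq [OF Dc [OF d] sub [OF d] dflt [OF d] j0(1)])
             (use j0(2) in \<open>auto simp: h_def intro!: prod.cong\<close>)
      qed
      then have "(\<Prod>d<N. measure_pmf.expectation (Dc d (sub x d)) (h d)) =
         (\<Prod>d<N. measure_pmf.expectation (Dc d (dflt d)) (h d))" for x
        by (intro prod.cong) auto
      then show ?thesis using \<open>N > 0\<close> lin_const [OF wfc, of 0]
        by (intro exI [of _ 0] conjI
            bexI [where x = "\<lambda>_. \<Prod>d<N. measure_pmf.expectation (Dc d (dflt d)) (h d)"]) auto
    qed
    then obtain e g where e: "e < N" and g: "g \<in> lin (ch e)"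
      and prod: "\<And>x. x \<in> strats t \<Longrightarrow>
        (\<Prod>d<N. measure_pmf.expectation (Dc d (sub x d)) (h d)) = g (sub x e)" by blast
    have f: "measure_pmf.expectation (D x) (\<lambda>ys. \<Prod>j<k. ys j (w j)) =
        (if \<sigma> = act x then \<kappa> * g (sub x e) else 0)" if x: "x \<in> strats t" for x
    proof -
      have "measure_pmf.expectation (D x) (\<lambda>ys. \<Prod>j<k. ys j (w j)) =
          measure_pmf.expectation (D x) (\<lambda>ys. \<Prod>j<k. ys j (a j # c j # v j))"
        by (intro expectation_cong prod.cong) (simp_all add: w_eq)
      also have "\<dots> = measure_pmf.prob (R x) {r. \<forall>j<k. r j = a j} *
          (\<Prod>d<N. measure_pmf.expectation (Dc d (sub x d)) (h d))"
        unfolding D_def h_def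
      proof (rule expectation_share_join [OF finR [OF x] fin])
        fix d ys j q assume d: "d < N" and ys: "ys \<in> set_pmf (Dc d (sub x d))" and j: "j < k"
        show "0 \<le> ys j q" by (rule strats_nonneg [OF sharingD(2) [OF Dc [OF d] sub [OF d] ys j]])
      qed (auto intro: c)
      also have "\<dots> = (if \<sigma> = act x then \<kappa> * g (sub x e) else 0)"
      proof -
        have "measure_pmf.prob (R x) {r. \<forall>j<k. r j = a j} =
            (if \<sigma> = act x then 1 / card (shares k m (act x)) else 0)"
          unfolding R_def \<sigma>_def by (rule prob_shares [OF k act [OF x] a])
        then show ?thesis unfolding prod [OF x] by (simp add: \<kappa>_def)
      qed
      finally show ?thesis .
    qed
    show ?thesis
    \<comment> \<open>If \<open>e\<close> is not the action \<sigma> that the shares add up to, then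
      playing \<sigma> puts the default below \<open>e\<close>, and a constant times the indicator
      of playing \<sigma> remains. Otherwise the functional reads the restriction of
      \<open>x\<close> to \<open>e\<close>.\<close>
    proof (cases "is_dec t \<and> e \<noteq> \<sigma>")
      case True
      then have \<sigma>: "\<sigma> < N" using \<open>\<sigma> < m\<close> m_dec by simp
      show ?thesis
      proof (rule lin_child [where c = \<sigma> and g = "\<lambda>_. \<kappa> * g (dflt e)"])
        show "(\<lambda>_. \<kappa> * g (dflt e)) \<in> lin (children t ! \<sigma>)"
          using lin_const [OF wfc [OF \<sigma>]] by (simp add: ch_def)
        show "\<sigma> < length (children t)" using \<sigma> by (simp add: N_def)
        fix x assume x: "x \<in> strats t"
        show "(\<lambda>q. x (\<sigma> # q)) \<in> strats (children t ! \<sigma>) \<and>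
            measure_pmf.expectation (D x) (\<lambda>ys. \<Prod>j<k. ys j (w j)) = \<kappa> * g (dflt e) \<or>
            (\<forall>q. x (\<sigma> # q) = 0) \<and> measure_pmf.expectation (D x) (\<lambda>ys. \<Prod>j<k. ys j (w j)) = 0"
          unfolding f [OF x] using act' [OF x] True sub_unplayed [OF x e] by (auto simp: ch_def)
      qed
    next
      case False
      show ?thesis
      proof (rule lin_child [where c = e and g = "\<lambda>x. \<kappa> * g x"])
        show "(\<lambda>x. \<kappa> * g x) \<in> lin (children t ! e)"
          using lin_cmult [OF g] by (simp add: ch_def)
        show "e < length (children t)" using e by (simp add: N_def)
        fix x assume x: "x \<in> strats t"
        have "\<sigma> = act x" if "\<not> is_dec t"
          using that m_obs \<open>\<sigma> < m\<close> act [OF x] by simp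
        then show "(\<lambda>q. x (e # q)) \<in> strats (children t ! e) \<and>
            measure_pmf.expectation (D x) (\<lambda>ys. \<Prod>j<k. ys j (w j)) = \<kappa> * g (\<lambda>q. x (e # q)) \<or>
            (\<forall>q. x (e # q) = 0) \<and> measure_pmf.expectation (D x) (\<lambda>ys. \<Prod>j<k. ys j (w j)) = 0"
          unfolding f [OF x] using act' [OF x] False sub_played [OF x e] e
          by (cases "is_dec t") (auto simp: ch_def)
      qed
    qed
  qed
  have "finite (set_pmf (D x))" if "x \<in> strats t" for x
    unfolding D_def by (rule finite_share_join [OF finR [OF that] fin])
  then have "sharing k t D"
    unfolding sharing_def using strat decode priv linear by blast
  then show ?thesis by blast
qed

lemma sharing_exists:
  assumes k: "k \<ge> 1"
  shows "wf_tree t \<Longrightarrow> \<exists>D. sharing k t D"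
proof (induction t rule: tree_children_induct)
  case (child t)
  show ?case
  proof (cases "t = Leaf")
    case True
    let ?x = "\<lambda>p::nat list. if p = [] then 1 else (0::real)"
    have "sharing k Leaf (\<lambda>_. return_pmf (\<lambda>_. ?x))"
    proof -
      have "z = []" if "aligned k Leaf z w" for z w using that by cases auto
      moreover have "(\<lambda>x. measure_pmf.expectation (return_pmf (\<lambda>_. ?x)) (\<lambda>ys. \<Prod>j<k. ys j (w j))) \<in> lin Leaf"
        if "\<And>j. j < k \<Longrightarrow> w j \<in> leaves (share_tree Leaf)" for w :: "nat \<Rightarrow> nat list"
        by (rule lin_const) (use child.prems True in simp)
      ultimately show ?thesis
        unfolding sharing_def by (auto simp: strats_Leaf)
    qed
    then show ?thesis using True by blast
  next
    case False
    have "\<exists>D. sharing k (children t ! c) D" if "c < length (children t)" for c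
      using child.IH [OF that] wf_tree_child [OF child.prems that] by simp
    then obtain Dc where "\<And>c. c < length (children t) \<Longrightarrow> sharing k (children t ! c) (Dc c)" by metis
    then show ?thesis by (rule sharing_node [OF k child.prems False])
  qed
qed

subsection \<open>Reconstructing the shared strategy\<close>

text \<open>A pure strategy is assembled from local moves: the environment cannot break
  \<open>I\<close>, and the player always has a move that keeps it. The reconstructing strategy is
  obtained this way and never written out.\<close>

lemma ipure_invariant:
  assumes "valid_state C s" "I s"
    and obs: "\<And>s s'. valid_state C s \<Longrightarrow> I s \<Longrightarrow> s' \<in> obs_succ C s \<Longrightarrow> I s'"
    and dec: "\<And>s. valid_state C s \<Longrightarrow> I s \<Longrightarrow> \<not> terminal_state C s \<Longrightarrow> \<not> has_obs C s \<Longrightarrow>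
      \<exists>s'\<in>dec_succ C s. I s'"
  shows "\<exists>m. ipure C s m \<and> (\<forall>h. thist C s h \<longrightarrow> m h \<noteq> 0 \<longrightarrow> I (last (s # h)))"
  using assms(1,2)
proof (induction rule: state_induct)
  case (state s)
  show ?case
  proof (cases "terminal_state C s")
    case True
    then show ?thesis
      by (intro exI [of _ "\<lambda>h. if h = [] then 1 else 0"] conjI ipure.tstop) (use state.prems in auto)
  next
    case nt: False
    show ?thesis
    proof (cases "has_obs C s")
      case True
      then have "\<exists>m. ipure C s' m \<and> (\<forall>h. thist C s' h \<longrightarrow> m h \<noteq> 0 \<longrightarrow> I (last (s' # h)))"
        if "s' \<in> obs_succ C s" for s'
        using state.IH [of s'] obs [OF state.hyps state.prems that] that by (simp add: succ_def)
      then obtain F where F: "\<And>s'. s' \<in> obs_succ C s \<Longrightarrow> ipure C s' (F s')"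
        "\<And>s' h. s' \<in> obs_succ C s \<Longrightarrow> thist C s' h \<Longrightarrow> F s' h \<noteq> 0 \<Longrightarrow> I (last (s' # h))"
        by metis
      let ?m = "\<lambda>h. case h of [] \<Rightarrow> 0 | s' # h' \<Rightarrow> if s' \<in> obs_succ C s then F s' h' else 0"
      have "ipure C s ?m" by (rule ipure.obs) (use nt True F in auto)
      moreover have "I (last (s # h))" if h: "thist C s h" "?m h \<noteq> 0" for h
        using h(1)
      proof cases
        case (step s' h')
        then show ?thesis using F(2) [of s' h'] h(2) by (auto split: if_splits)
      qed (use nt in simp)
      ultimately show ?thesis by blast
    next
      case False
      obtain s' where s': "s' \<in> dec_succ C s" "I s'"
        using dec [OF state.hyps state.prems nt False] by blast
      then obtain x where x: "ipure C s' x" "\<And>h. thist C s' h \<Longrightarrow> x h \<noteq> 0 \<Longrightarrow> I (last (s' # h))"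
        using state.IH [of s'] False by (auto simp: succ_def)
      let ?m = "\<lambda>h. case h of [] \<Rightarrow> 0 | s'' # h' \<Rightarrow> if s'' = s' then x h' else 0"
      have "ipure C s ?m" by (rule ipure.dec) (use nt False s' x in auto)
      moreover have "I (last (s # h))" if h: "thist C s h" "?m h \<noteq> 0" for h
        using h(1)
      proof cases
        case (step s'' h')
        then show ?thesis using x(2) [of h'] h(2) by (auto split: if_splits)
      qed (use nt in simp)
      ultimately show ?thesis by blast
    qed
  qed
qed

text \<open>An address in a share tree alternates between shares (even positions) and claims.\<close>
fun claims :: "nat list \<Rightarrow> nat list" where
  "claims (r # a # w) = a # claims w"
| "claims _ = []"

lemma length_claims: "length (claims w) = length w div 2"
  by (induction w rule: claims.induct) auto

lemma claims_snoc: "claims (w @ [a]) = (if even (length w) then claims w else claims w @ [a])"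
  by (induction w rule: claims.induct) auto

lemma nodeat_share_tree:
  "nodeat (share_tree t) w = Some v \<Longrightarrow> \<exists>u. nodeat t (claims w) = Some u \<and>
     (if even (length w) then v = share_tree u
      else u \<noteq> Leaf \<and> v = Obs (map share_tree (children u)))"
proof (induction w arbitrary: t rule: claims.induct)
  case (1 r a w)
  then have nl: "t \<noteq> Leaf" by auto
  have "a < length (children t)" "nodeat (share_tree (children t ! a)) w = Some v"
    using "1.prems" by (auto simp: share_tree_nonleaf [OF nl] split: if_splits)
  then show ?case using "1.IH" [of "children t ! a"] by simp
next
  case ("2_2" r)
  then have nl: "t \<noteq> Leaf" by auto
  then show ?case using "2_2" by (auto simp: share_tree_nonleaf [OF nl] split: if_splits)
qed auto

text \<open>The share for depth \<open>t\<close> stands at position \<open>2 * t\<close> of an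
  address, since each level contributes a share and a claim. The length condition says that every
  copy has already revealed it, so later moves cannot change the sum.\<close>

definition consistent :: "nat \<Rightarrow> tree \<Rightarrow> nat list \<Rightarrow> (nat \<Rightarrow> nat list) \<Rightarrow> bool" where
  "consistent k X z ws \<longleftrightarrow> (\<forall>t u. t < length z \<longrightarrow> nodeat X (take t z) = Some u \<longrightarrow> is_dec u \<longrightarrow>
     (\<forall>j<k. 2 * t < length (ws j)) \<and> (\<Sum>j<k. ws j ! (2 * t)) mod length (children u) = z ! t)"

lemma consistent_extend:
  assumes "consistent k X z ws" "\<And>j. j < k \<Longrightarrow> \<exists>r. ws' j = ws j @ r"
  shows "consistent k X z ws'"
  unfolding consistent_def
proof (intro allI impI)
  fix t u assume t: "t < length z" "nodeat X (take t z) = Some u" "is_dec u"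
  have *: "\<forall>j<k. 2 * t < length (ws j)" "(\<Sum>j<k. ws j ! (2 * t)) mod length (children u) = z ! t"
    using assms(1) t unfolding consistent_def by blast+
  have "2 * t < length (ws' j) \<and> ws' j ! (2 * t) = ws j ! (2 * t)" if "j < k" for j
    using * assms(2) [OF that] that by (auto simp: nth_append)
  moreover from this have "(\<Sum>j<k. ws' j ! (2 * t)) = (\<Sum>j<k. ws j ! (2 * t))"
    by (intro sum.cong) auto
  ultimately show "(\<forall>j<k. 2 * t < length (ws' j)) \<and>
      (\<Sum>j<k. ws' j ! (2 * t)) mod length (children u) = z ! t"
    using * by simp
qed

lemma consistent_snoc:
  assumes "consistent k X z ws"
    "\<And>u. nodeat X z = Some u \<Longrightarrow> is_dec u \<Longrightarrow> (\<forall>j<k. 2 * length z < length (ws j)) \<and>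
      (\<Sum>j<k. ws j ! (2 * length z)) mod length (children u) = a"
  shows "consistent k X (z @ [a]) ws"
  unfolding consistent_def
proof (intro allI impI)
  fix t u assume t: "t < length (z @ [a])" "nodeat X (take t (z @ [a])) = Some u" "is_dec u"
  show "(\<forall>j<k. 2 * t < length (ws j)) \<and>
      (\<Sum>j<k. ws j ! (2 * t)) mod length (children u) = (z @ [a]) ! t"
  proof (cases "t = length z")
    case True
    then show ?thesis using assms(2) [of u] t by simp
  next
    case False
    then have "t < length z" "nodeat X (take t z) = Some u" using t by simp_all
    then show ?thesis using assms(1) t(3) unfolding consistent_def by (simp add: nth_append)
  qed
qed

text \<open>Passes from the condition by positions, convenient while addresses grow at their ends,
  to the recursive one, which matches how a sharing is built from the root.\<close>

lemma aligned_of_consistent: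
  "nodeat X z = Some Leaf \<Longrightarrow> (\<And>j. j < k \<Longrightarrow> claims (ws j) = z) \<Longrightarrow> consistent k X z ws \<Longrightarrow>
     aligned k X z ws"
proof (induction z arbitrary: X ws)
  case Nil
  then show ?case by (auto intro: aligned.leaf)
next
  case (Cons a z)
  have a: "a < length (children X)" "nodeat (children X ! a) z = Some Leaf"
    using Cons.prems(1) by (auto split: if_splits)
  have "\<exists>r w'. ws j = r # a # w' \<and> claims w' = z" if "j < k" for j
    using Cons.prems(2) [OF that] by (cases "ws j" rule: claims.cases) auto
  then obtain r w' where ws: "\<And>j. j < k \<Longrightarrow> ws j = r j # a # w' j" and cl: "\<And>j. j < k \<Longrightarrow> claims (w' j) = z"
    by metis
  have con: "(\<forall>j<k. 2 * t < length (ws j)) \<and>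
     (\<Sum>j<k. ws j ! (2 * t)) mod length (children u) = (a # z) ! t"
    if "t < Suc (length z)" "nodeat X (take t (a # z)) = Some u" "is_dec u" for t u
    using Cons.prems(3) that unfolding consistent_def by simp
  have "consistent k (children X ! a) z w'"
    unfolding consistent_def
  proof (intro allI impI)
    fix t u assume t: "t < length z" "nodeat (children X ! a) (take t z) = Some u" "is_dec u"
    have *: "(\<forall>j<k. 2 * Suc t < length (ws j)) \<and>
      (\<Sum>j<k. ws j ! (2 * Suc t)) mod length (children u) = (a # z) ! Suc t"
      by (rule con) (use t a in auto)
    have "(\<Sum>j<k. ws j ! (2 * Suc t)) = (\<Sum>j<k. w' j ! (2 * t))"
      by (rule sum.cong) (simp_all add: ws)
    then show "(\<forall>j<k. 2 * t < length (w' j)) \<and>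
      (\<Sum>j<k. w' j ! (2 * t)) mod length (children u) = z ! t"
      using * ws by auto
  qed
  then have "aligned k (children X ! a) z w'" using Cons.IH a(2) cl by blast
  moreover have "(\<Sum>j<k. r j) mod length (children X) = a" if "is_dec X"
  proof -
    have "(\<Sum>j<k. ws j ! (2 * 0)) mod length (children X) = (a # z) ! 0"
      using con [of 0 X] that by simp
    moreover have "(\<Sum>j<k. ws j ! (2 * 0)) = (\<Sum>j<k. r j)"
      by (rule sum.cong) (simp_all add: ws)
    ultimately show ?thesis by simp
  qed
  ultimately show ?case using a(1) ws by (intro aligned.node [where r = r and w' = w']) auto
qed

definition share_root :: "nat \<Rightarrow> tree \<Rightarrow> tree" where
  "share_root k X = Obs (replicate k (share_tree X))"

lemma wf_share_root: "k \<ge> 1 \<Longrightarrow> wf_tree X \<Longrightarrow> wf_tree (share_root k X)"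
  unfolding share_root_def
  by (rule wf_treeI) (use not_is_obs_share_tree wf_share_tree in auto)

text \<open>Component \<open>Suc j\<close> is reserved for copy \<open>j\<close>, whose index
  \<open>tl\<close> strips from the address. The claims made in a copy are a prefix of the path in
  \<open>X\<close>: copies may lag behind, but never leave that path.\<close>

definition recon_inv :: "nat \<Rightarrow> tree \<Rightarrow> state \<Rightarrow> bool" where
  "recon_inv k X s \<longleftrightarrow> (\<forall>j<k. (s ! Suc j \<noteq> [] \<longrightarrow> hd (s ! Suc j) = j) \<and>
     (\<exists>q. s ! 0 = claims (tl (s ! Suc j)) @ q)) \<and>
   consistent k X (s ! 0) (\<lambda>j. tl (s ! Suc j))"

section \<open>The reconstructing mediator\<close>

context
  fixes k :: nat and X :: tree and C :: "tree list"
  assumes k: "k \<ge> 1" and wf: "wf_tree X"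
  defines C: "C \<equiv> X # replicate k (dual (share_root k X))"
begin

text \<open>After an even number of steps inside the copy, the environment is about to reveal a
  share or the copy has ended; after an odd number, the mediator has to make a claim.\<close>

lemma recon_component:
  assumes "valid_state C s" "recon_inv k X s" "j < k" "s ! Suc j \<noteq> []"
  obtains w u where "s ! Suc j = j # w" "nodeat X (claims w) = Some u"
    "cur C s (Suc j) = dual (if even (length w) then share_tree u else Obs (map share_tree (children u)))"
    "even (length w) \<or> u \<noteq> Leaf"
proof -
  have "hd (s ! Suc j) = j" using assms(2-4) by (simp add: recon_inv_def)
  then obtain w where w: "s ! Suc j = j # w" using assms(4) by (cases "s ! Suc j") auto
  have "nodeat (dual (share_root k X)) (j # w) = Some (cur C s (Suc j))"
    using nodeat_cur [OF assms(1), of "Suc j"] assms(3) w by (simp add: C)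
  then obtain v where "nodeat (share_tree X) w = Some v" "cur C s (Suc j) = dual v"
    using assms(3) by (auto simp: share_root_def nodeat_dual)
  moreover from this obtain u where "nodeat X (claims w) = Some u"
    "if even (length w) then v = share_tree u else u \<noteq> Leaf \<and> v = Obs (map share_tree (children u))"
    using nodeat_share_tree by blast
  ultimately show ?thesis using that [of w u] w by (cases "even (length w)") auto
qed

lemma cur_root_component:
  assumes "valid_state C s" "j < k" "s ! Suc j = []"
  shows "cur C s (Suc j) = Dec (replicate k (dual (share_tree X)))"
  using nodeat_cur [OF assms(1), of "Suc j"] assms(2,3) by (simp add: C share_root_def)

lemma nodeat_X:
  assumes "valid_state C s"
  shows "nodeat X (s ! 0) = Some (cur C s 0)"
  using nodeat_cur [OF assms, of 0] by (simp add: C)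

lemma length_state: "valid_state C s \<Longrightarrow> length s = Suc k"
  by (simp add: valid_state_def C)

text \<open>Environment moves inside a copy add shares and leave the claims alone; those in
  \<open>X\<close> happen at observation points, where \<open>consistent\<close> makes no
  demand.\<close>

lemma recon_inv_obs:
  assumes v: "valid_state C s" and I: "recon_inv k X s" and s': "s' \<in> obs_succ C s"
  shows "recon_inv k X s'"
proof -
  have ext: "(s' ! Suc j \<noteq> [] \<longrightarrow> hd (s' ! Suc j) = j) \<and>
      claims (tl (s' ! Suc j)) = claims (tl (s ! Suc j)) \<and> (\<exists>r. tl (s' ! Suc j) = tl (s ! Suc j) @ r)"
    if j: "j < k" for j
  proof (cases "is_obs (cur C s (Suc j))")
    case True
    then obtain r where r: "s' ! Suc j = s ! Suc j @ [r]"
      using obs_succ_component [OF v s', of "Suc j"] j by (auto simp: C)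
    have ne: "s ! Suc j \<noteq> []" using True cur_root_component [OF v j] by auto
    obtain w u where w: "s ! Suc j = j # w"
      "cur C s (Suc j) = dual (if even (length w) then share_tree u else Obs (map share_tree (children u)))"
      by (rule recon_component [OF v I j ne])
    have "even (length w)" using True w(2) by (auto split: if_splits)
    then show ?thesis using w r by (simp add: claims_snoc)
  next
    case False
    then have "s' ! Suc j = s ! Suc j"
      using obs_succ_component [OF v s', of "Suc j"] j by (simp add: C)
    then show ?thesis using I j by (simp add: recon_inv_def)
  qed
  have con: "consistent k X (s ! 0) (\<lambda>j. tl (s' ! Suc j))"
    by (rule consistent_extend) (use I ext in \<open>auto simp: recon_inv_def\<close>)
  show ?thesis
  proof (cases "is_obs (cur C s 0)")
    case True
    then obtain a where a: "s' ! 0 = s ! 0 @ [a]"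
      using obs_succ_component [OF v s', of 0] by (auto simp: C)
    have "\<not> is_dec u" if "nodeat X (s ! 0) = Some u" for u
      using that True nodeat_X [OF v] by (cases u) auto
    then have "consistent k X (s' ! 0) (\<lambda>j. tl (s' ! Suc j))"
      unfolding a by (intro consistent_snoc con) auto
    then show ?thesis using I ext a by (fastforce simp: recon_inv_def)
  next
    case False
    then have "s' ! 0 = s ! 0"
      using obs_succ_component [OF v s', of 0] by (simp add: C)
    then show ?thesis using I ext con by (simp add: recon_inv_def)
  qed
qed

text \<open>The mediator opens unopened copies, lets lagging copies claim the next step of the path
  in \<open>X\<close>, and moves in \<open>X\<close> only when no copy is unopened or lagging: by
  then all shares for the current decision are known.\<close>

lemma recon_inv_dec:
  assumes v: "valid_state C s" and I: "recon_inv k X s"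
    and nt: "\<not> terminal_state C s" and no: "\<not> has_obs C s"
  shows "\<exists>s'\<in>dec_succ C s. recon_inv k X s'"
proof -
  note len = length_state [OF v]
  have prefix: "\<exists>q. s ! 0 = claims (tl (s ! Suc j)) @ q" if "j < k" for j
    using I that by (simp add: recon_inv_def)
  have con: "consistent k X (s ! 0) (\<lambda>j. tl (s ! Suc j))" using I by (simp add: recon_inv_def)
  have no': "\<not> is_obs (cur C s j)" if "j < Suc k" for j
    using no that len by (auto simp: has_obs_def)
  consider j where "j < k" "s ! Suc j = []"
    | j w where "j < k" "s ! Suc j = j # w" "odd (length w)" "length (claims w) < length (s ! 0)"
    | "\<forall>j<k. \<exists>w. s ! Suc j = j # w \<and> (odd (length w) \<longrightarrow> length (claims w) \<ge> length (s ! 0))"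
  proof (cases "\<forall>j<k. s ! Suc j \<noteq> []")
    case True
    then have "\<exists>w. s ! Suc j = j # w" if "j < k" for j
      using I that by (cases "s ! Suc j") (auto simp: recon_inv_def)
    then show ?thesis using that(2,3) by (meson not_le_imp_less)
  qed (use that(1) in blast)
  then show ?thesis
  proof cases
    case 1
    define s' where "s' = s[Suc j := [j]]"
    have "s' \<in> dec_succ C s"
      unfolding dec_succ_def s'_def using 1 len cur_root_component [OF v 1]
      by (intro CollectI exI [of _ "Suc j"] exI [of _ j]) simp
    moreover have "tl (s' ! Suc i) = tl (s ! Suc i)" for i
      using 1 len by (cases "i = j") (auto simp: s'_def)
    moreover have "s' ! Suc i \<noteq> [] \<longrightarrow> hd (s' ! Suc i) = i" if "i < k" for i
      using I 1 len that by (cases "i = j") (auto simp: s'_def recon_inv_def)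
    moreover have "s' ! 0 = s ! 0" by (simp add: s'_def)
    ultimately show ?thesis using prefix con
      by (intro bexI [of _ s']) (simp_all add: recon_inv_def)
  next
    case 2
    \<comment> \<open>The claim that tells the truth: the next step of the path already taken in
      \<open>X\<close>.\<close>
    define a where "a = s ! 0 ! length (claims w)"
    define s' where "s' = s[Suc j := s ! Suc j @ [a]]"
    have ne: "s ! Suc j \<noteq> []" using 2 by simp
    obtain u where u: "nodeat X (claims w) = Some u"
      and cu: "cur C s (Suc j) = dual (Obs (map share_tree (children u)))"
      by (rule recon_component [OF v I 2(1) ne]) (use 2 in auto)
    obtain q where q: "s ! 0 = claims w @ q" using prefix [OF 2(1)] 2(2) by auto
    then obtain q' where q': "s ! 0 = claims w @ a # q'"
      using 2(4) by (cases q) (auto simp: a_def)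
    have "a < length (children u)"
      using nodeat_X [OF v] u unfolding q' by (auto simp: nodeat_append split: if_splits)
    then have "s' \<in> dec_succ C s"
      unfolding dec_succ_def s'_def using 2 len cu
      by (intro CollectI exI [of _ "Suc j"] exI [of _ a]) simp
    moreover have s0: "s' ! 0 = s ! 0" and s_other: "\<And>i. i \<noteq> j \<Longrightarrow> s' ! Suc i = s ! Suc i"
      and s_j: "s' ! Suc j = j # w @ [a]"
      using 2 len by (simp_all add: s'_def)
    moreover have "consistent k X (s' ! 0) (\<lambda>j. tl (s' ! Suc j))"
      unfolding s0
    proof (rule consistent_extend [OF con])
      fix i show "\<exists>r. tl (s' ! Suc i) = tl (s ! Suc i) @ r"
        using s_other [of i] s_j 2(2) by (cases "i = j") auto
    qed
    moreover have "\<exists>q. s' ! 0 = claims (tl (s' ! Suc i)) @ q" if "i < k" for i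
      using s_other [of i] s_j s0 prefix [OF that] q' 2(3) by (cases "i = j") (auto simp: claims_snoc)
    moreover have "s' ! Suc i \<noteq> [] \<longrightarrow> hd (s' ! Suc i) = i" if "i < k" for i
      using I that s_other [of i] s_j by (cases "i = j") (auto simp: recon_inv_def)
    ultimately show ?thesis
      by (intro bexI [of _ s']) (simp_all only: recon_inv_def, blast)
  next
    case 3
    \<comment> \<open>With nothing lagging and no observation pending, every copy has either ended
      together with \<open>X\<close> or revealed its share at the current depth; that share accounts
      for the \<open>Suc\<close>.\<close>
    have comp: "if cur C s 0 = Leaf then cur C s (Suc j) = Leaf
        else length (tl (s ! Suc j)) = Suc (2 * length (s ! 0))" if j: "j < k" for j
    proof -
      obtain w0 where w0: "s ! Suc j = j # w0" "odd (length w0) \<Longrightarrow> length (claims w0) \<ge> length (s ! 0)"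
        using 3 j by blast
      then have ne: "s ! Suc j \<noteq> []" by simp
      obtain w u where w: "s ! Suc j = j # w" and u: "nodeat X (claims w) = Some u" and
        cu: "cur C s (Suc j) = dual (if even (length w) then share_tree u else Obs (map share_tree (children u)))"
        and nl: "even (length w) \<or> u \<noteq> Leaf"
        by (rule recon_component [OF v I j ne])
      obtain q where q: "s ! 0 = claims w @ q" using prefix [OF j] w by auto
      show ?thesis
      proof (cases "even (length w)")
        case True
        have "u = Leaf"
        proof (rule ccontr)
          assume "u \<noteq> Leaf"
          then have "is_obs (cur C s (Suc j))" using cu True by (simp add: share_tree_nonleaf)
          then show False using no' [of "Suc j"] j by simp
        qed
        then have "q = []" using nodeat_X [OF v] u q by (cases q) (auto simp: nodeat_append)
        then have "cur C s 0 = Leaf" using nodeat_X [OF v] u q \<open>u = Leaf\<close> by simp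
        then show ?thesis using cu True \<open>u = Leaf\<close> by simp
      next
        case False
        then have "length (claims w) \<ge> length (s ! 0)" using w w0 by simp
        then have "q = []" using q by simp
        then have "cur C s 0 = u" using nodeat_X [OF v] u q by simp
        moreover have "length w = Suc (2 * length (s ! 0))"
          using False q \<open>q = []\<close> length_claims [of w] by (simp add: odd_two_times_div_two_succ)
        ultimately show ?thesis using nl False w by simp
      qed
    qed
    have "cur C s 0 \<noteq> Leaf"
    proof
      assume "cur C s 0 = Leaf"
      then have "cur C s j = Leaf" if "j < Suc k" for j
        using comp that by (cases j) auto
      then show False using nt len by (simp add: terminal_state_def)
    qed
    then obtain us where us: "cur C s 0 = Dec us" using no' [of 0] by (cases "cur C s 0") auto
    have lw: "2 * length (s ! 0) < length (tl (s ! Suc j))" if "j < k" for j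
      using comp [OF that] us by simp
    define a where "a = (\<Sum>j<k. tl (s ! Suc j) ! (2 * length (s ! 0))) mod length us"
    have "us \<noteq> []"
      using wf_tree_nonempty [OF wf_tree_nodeat [OF wf nodeat_X [OF v]]] us by simp
    then have a: "a < length us" by (simp add: a_def)
    define s' where "s' = s[0 := s ! 0 @ [a]]"
    have "s' \<in> dec_succ C s"
      unfolding dec_succ_def s'_def using len us a
      by (intro CollectI exI [of _ 0] exI [of _ a]) simp
    moreover have s0: "s' ! 0 = s ! 0 @ [a]" and sS: "\<And>i. s' ! Suc i = s ! Suc i"
      using len by (simp_all add: s'_def)
    moreover have "consistent k X (s' ! 0) (\<lambda>j. tl (s' ! Suc j))"
      unfolding s0 sS
    proof (rule consistent_snoc [OF con])
      fix u assume "nodeat X (s ! 0) = Some u"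
      then have "u = Dec us" using nodeat_X [OF v] us by simp
      then show "(\<forall>j<k. 2 * length (s ! 0) < length (tl (s ! Suc j))) \<and>
        (\<Sum>j<k. tl (s ! Suc j) ! (2 * length (s ! 0))) mod length (children u) = a"
        using lw by (simp add: a_def)
    qed
    moreover have "\<exists>q. s' ! 0 = claims (tl (s' ! Suc i)) @ q" if "i < k" for i
      using prefix [OF that] unfolding s0 sS by auto
    moreover have "s' ! Suc i \<noteq> [] \<longrightarrow> hd (s' ! Suc i) = i" if "i < k" for i
      using I that by (simp add: sS recon_inv_def)
    ultimately show ?thesis
      by (intro bexI [of _ s']) (simp_all only: recon_inv_def, blast)
  qed
qed

text \<open>The claims of a finished copy spell a leaf of \<open>X\<close>. They are also a prefix
  of the leaf reached in \<open>X\<close>, hence equal to it.\<close>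

lemma recon_aligned:
  assumes v: "valid_state C s" and I: "recon_inv k X s" and t: "terminal_state C s"
  shows "aligned k X (s ! 0) (\<lambda>j. tl (s ! Suc j)) \<and> (\<forall>j<k. s ! Suc j = j # tl (s ! Suc j))"
proof -
  have leaf: "cur C s j = Leaf" if "j < Suc k" for j
    using t that length_state [OF v] by (simp add: terminal_state_def)
  have X: "nodeat X (s ! 0) = Some Leaf" using nodeat_X [OF v] leaf [of 0] by simp
  have ne: "s ! Suc j \<noteq> []" if "j < k" for j
    using cur_root_component [OF v that] leaf [of "Suc j"] that by auto
  have "claims (tl (s ! Suc j)) = s ! 0" if j: "j < k" for j
  proof -
    obtain w u where w: "s ! Suc j = j # w" and u: "nodeat X (claims w) = Some u" and
        cu: "cur C s (Suc j) = dual (if even (length w) then share_tree u else Obs (map share_tree (children u)))"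
      by (rule recon_component [OF v I j ne [OF j]])
    have "u = Leaf"
    proof (rule ccontr)
      assume "u \<noteq> Leaf"
      then show False using cu leaf [of "Suc j"] j by (simp add: share_tree_nonleaf split: if_splits)
    qed
    obtain q where q: "s ! 0 = claims w @ q" using I j w by (auto simp: recon_inv_def)
    then have "q = []" using X u \<open>u = Leaf\<close> by (cases q) (auto simp: nodeat_append)
    then show ?thesis using q w by simp
  qed
  then have "aligned k X (s ! 0) (\<lambda>j. tl (s ! Suc j))"
    using X I by (intro aligned_of_consistent) (auto simp: recon_inv_def)
  moreover have "s ! Suc j = j # tl (s ! Suc j)" if "j < k" for j
    using ne [OF that] I that by (cases "s ! Suc j") (auto simp: recon_inv_def)
  ultimately show ?thesis by blast
qed

lemma recon_strategy:
  obtains m where "ipure C (root_state C) m"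
    "\<And>h. thist C (root_state C) h \<Longrightarrow> m h \<noteq> 0 \<Longrightarrow>
      aligned k X (last (root_state C # h) ! 0) (\<lambda>j. tl (last (root_state C # h) ! Suc j)) \<and>
      (\<forall>j<k. last (root_state C # h) ! Suc j = j # tl (last (root_state C # h) ! Suc j))"
proof -
  have "recon_inv k X (root_state C)"
    by (simp add: recon_inv_def consistent_def root_state_def C)
  then have "\<exists>m. ipure C (root_state C) m \<and>
      (\<forall>h. thist C (root_state C) h \<longrightarrow> m h \<noteq> 0 \<longrightarrow> recon_inv k X (last (root_state C # h)))"
    by (rule ipure_invariant [OF valid_root_state])
       (fact recon_inv_obs, fact recon_inv_dec)
  then obtain m where m: "ipure C (root_state C) m"
    "\<And>h. thist C (root_state C) h \<Longrightarrow> m h \<noteq> 0 \<Longrightarrow> recon_inv k X (last (root_state C # h))"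
    by blast
  show ?thesis
    by (rule that [OF m(1)]) (use m(2) recon_aligned thist_last [OF _ valid_root_state] in blast)
qed

end

subsection \<open>Generalized equilibria\<close>

definition share_vec :: "nat \<Rightarrow> (nat \<Rightarrow> vec) \<Rightarrow> vec" where
  "share_vec k ys = (\<lambda>p. case p of [] \<Rightarrow> 0 | j # q \<Rightarrow> if j < k then ys j q else 0)"

lemma share_vec_strats:
  "(\<And>j. j < k \<Longrightarrow> ys j \<in> strats (share_tree X)) \<Longrightarrow> share_vec k ys \<in> strats (share_root k X)"
  by (simp add: share_root_def strats_Obs_iff share_vec_def)

text \<open>Having as many copies as queries enters here: either the queries hit the copies in a
  permutation, and the product has one leaf from each copy, or they miss a copy, and privacy makes
  the expectation constant.\<close>

lemma share_vec_monomial_lin: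
  assumes k: "k \<ge> 1" and wf: "wf_tree X" and D: "sharing k X D"
    and zs: "zs \<in> listset (replicate k (leaves (share_root k X)))"
  shows "(\<lambda>x. measure_pmf.expectation (D x) (\<lambda>ys. \<Prod>i<k. share_vec k ys (zs ! i))) \<in> lin X"
proof -
  have "\<exists>j w. zs ! i = j # w \<and> j < k \<and> w \<in> leaves (share_tree X)" if "i < k" for i
    using zs that by (auto simp: in_listset_iff share_root_def leaves_nonleaf)
  then obtain j w where zs_eq: "\<And>i. i < k \<Longrightarrow> zs ! i = j i # w i" and j: "\<And>i. i < k \<Longrightarrow> j i < k"
    and w: "\<And>i. i < k \<Longrightarrow> w i \<in> leaves (share_tree X)"
    by metis
  have eq: "(\<Prod>i<k. share_vec k ys (zs ! i)) = (\<Prod>i<k. ys (j i) (w i))" for ys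
    by (rule prod.cong) (simp_all add: zs_eq share_vec_def j)
  show ?thesis
  proof (cases "j ` {..<k} = {..<k}")
    case True
    then have inj: "inj_on j {..<k}" by (intro eq_card_imp_inj_on) auto
    \<comment> \<open>The queried leaves, reindexed by the copy in which they lie.\<close>
    define w' where "w' l = w (the_inv_into {..<k} j l)" for l
    have w': "w' (j i) = w i" if "i < k" for i
      using inj that by (simp add: w'_def the_inv_into_f_f)
    have eq': "(\<Prod>l<k. ys l (w' l)) = (\<Prod>i<k. ys (j i) (w i))" for ys :: "nat \<Rightarrow> vec"
      by (rule prod.reindex_cong [OF inj True [symmetric]]) (simp add: w')
    have "w' l \<in> leaves (share_tree X)" if l: "l < k" for l
    proof -
      have "l \<in> j ` {..<k}" using True l by simp
      then obtain i where "i < k" "l = j i" by auto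
      then show ?thesis using w' w by simp
    qed
    then show ?thesis unfolding eq eq' [symmetric] by (rule sharingD(5) [OF D])
  next
    case False
    then obtain j0 where j0: "j0 < k" "j0 \<notin> j ` {..<k}" using j by auto
    obtain x0 where x0: "x0 \<in> strats X" using pure_strat_ex [OF wf] by (auto simp: strats_def)
    show ?thesis unfolding eq
    proof (rule lin_cong [OF lin_const [OF wf]])
      fix x assume x: "x \<in> strats X"
      show "measure_pmf.expectation (D x) (\<lambda>ys. \<Prod>i<k. ys (j i) (w i)) =
          measure_pmf.expectation (D x0) (\<lambda>ys. \<Prod>i<k. ys (j i) (w i))"
        by (rule sharing_expectation_eq [OF D x x0 j0(1)])
           (use j0(2) in \<open>auto intro!: prod.cong\<close>)
    qed
  qed
qed

section \<open>Averaged deviations as linear maps\<close>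

lemma expectation_sum_finite:
  fixes f :: "'i \<Rightarrow> 'a \<Rightarrow> real"
  assumes "finite (set_pmf p)"
  shows "measure_pmf.expectation p (\<lambda>x. \<Sum>i\<in>I. f i x) = (\<Sum>i\<in>I. measure_pmf.expectation p (f i))"
  by (rule Bochner_Integration.integral_sum) (rule integrable_measure_pmf_finite [OF assms])

lemma lin_realize:
  assumes "\<And>z. (\<lambda>x. f x z) \<in> lin X"
  obtains L where "linear_fn L" "\<And>x. x \<in> strats X \<Longrightarrow> L x = f x"
proof -
  obtain c where c: "\<And>z x. x \<in> strats X \<Longrightarrow> f x z = (\<Sum>w\<in>leaves X. c z w * x w)"
    using assms unfolding lin_def mem_Collect_eq by metis
  show ?thesis
  proof (rule that)
    show "linear_fn (\<lambda>x z. \<Sum>w\<in>leaves X. c z w * x w)"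
      by (simp add: linear_fn_def fun_eq_iff sum.distrib algebra_simps sum_distrib_left)
    show "(\<lambda>z. \<Sum>w\<in>leaves X. c z w * x w) = f x" if "x \<in> strats X" for x
      using c [OF that] by auto
  qed
qed

text \<open>All that concerns a single player. \<open>E x\<close> is a random encoding of
  \<open>x\<close> that \<open>\<phi>\<close> decodes without error, and averaging a deviation over
  \<open>E x\<close> is linear in \<open>x\<close> because the deviation is a sum of monomials. The
  average stays in the hull since each value of the deviation lies there.\<close>

lemma mediator_encoding:
  assumes k: "k \<ge> 1" and wf: "wf_tree X"
  shows "\<exists>Y \<phi> E. wf_tree Y \<and> \<phi> \<in> Phi_med k Y X \<and> \<phi> ` strats Y \<subseteq> strats X \<and>
    (\<forall>x\<in>strats X. set_pmf (E x) \<subseteq> strats Y \<and> (\<forall>y\<in>set_pmf (E x). \<phi> y = x)) \<and>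
    (\<forall>\<phi>'\<in>Phi_med k Y X. \<exists>L. linear_fn L \<and> L ` strats X \<subseteq> cohull (strats X) \<and>
       (\<forall>x\<in>strats X. L x = (\<lambda>z. measure_pmf.expectation (E x) (\<lambda>y. \<phi>' y z))))"
proof -
  obtain D where D: "sharing k X D" using sharing_exists [OF k wf] by blast
  define Y where "Y = share_root k X"
  define C where "C = X # replicate k (dual (share_root k X))"
  have C': "C = X # replicate k (dual Y)" by (simp add: C_def Y_def)
  define E where "E x = map_pmf (share_vec k) (D x)" for x
  obtain m where m: "ipure C (root_state C) m" and
    al: "\<And>h. thist C (root_state C) h \<Longrightarrow> m h \<noteq> 0 \<Longrightarrow>
      aligned k X (last (root_state C # h) ! 0) (\<lambda>j. tl (last (root_state C # h) ! Suc j)) \<and>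
      (\<forall>j<k. last (root_state C # h) ! Suc j = j # tl (last (root_state C # h) ! Suc j))"
    using recon_strategy [OF k wf, folded C_def] by blast
  obtain \<phi> where \<phi>: "\<phi> \<in> Phi_med k Y X"
    and \<phi>_eq: "\<phi> = (\<lambda>y z. outcome C (root_state C) m (weight k (\<lambda>_. y) z))"
    by (rule ipure_phi_med [OF C' m])
  have \<phi>_strat: "\<phi> y \<in> strats X" if "y \<in> strats Y" for y
    unfolding \<phi>_eq by (rule outcome_root_strats [OF C' m that])
  have E_strat: "y \<in> strats Y" if "x \<in> strats X" "y \<in> set_pmf (E x)" for x y
    using that sharingD(2) [OF D] unfolding Y_def by (auto simp: E_def intro!: share_vec_strats)
  have decode: "\<phi> y = x" if x: "x \<in> strats X" and y: "y \<in> set_pmf (E x)" for x y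
  proof -
    obtain ys where ys: "ys \<in> set_pmf (D x)" "y = share_vec k ys" using y by (auto simp: E_def)
    have "x z \<noteq> 0" if "\<phi> y z \<noteq> 0" for z
    proof -
      have "\<exists>h. thist C (root_state C) h \<and> m h * weight k (\<lambda>_. y) z (last (root_state C # h)) \<noteq> 0"
      proof (rule ccontr)
        assume "\<nexists>h. thist C (root_state C) h \<and> m h * weight k (\<lambda>_. y) z (last (root_state C # h)) \<noteq> 0"
        then have "outcome C (root_state C) m (weight k (\<lambda>_. y) z) = 0"
          unfolding outcome_def by (intro sum.neutral) blast
        then show False using that by (simp add: \<phi>_eq)
      qed
      then obtain h where h: "thist C (root_state C) h" "m h \<noteq> 0"
        and wt: "weight k (\<lambda>_. y) z (last (root_state C # h)) \<noteq> 0" by (metis mult_eq_0_iff)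
      define t where "t = last (root_state C # h)"
      have z: "t ! 0 = z" and nz: "\<And>i. i < k \<Longrightarrow> y (t ! Suc i) \<noteq> 0"
        using wt unfolding t_def [symmetric] weight_def by (auto split: if_splits)
      have a: "aligned k X z (\<lambda>j. tl (t ! Suc j))" and hd: "\<And>j. j < k \<Longrightarrow> t ! Suc j = j # tl (t ! Suc j)"
        using al [OF h, folded t_def] z by blast+
      have "ys j (tl (t ! Suc j)) \<noteq> 0" if "j < k" for j
      proof -
        have "y (j # tl (t ! Suc j)) \<noteq> 0" using nz [OF that] hd [OF that] by simp
        then show ?thesis using that by (simp add: ys(2) share_vec_def)
      qed
      then show ?thesis by (rule sharingD(3) [OF D x ys(1) a])
    qed
    moreover have "pure_strat X (\<phi> y)" "pure_strat X x"
      using \<phi>_strat [OF E_strat [OF x y]] x by (simp_all add: strats_def)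
    ultimately show ?thesis using pure_strat_eqI wf by blast
  qed
  have dev: "\<exists>L. linear_fn L \<and> L ` strats X \<subseteq> cohull (strats X) \<and>
       (\<forall>x\<in>strats X. L x = (\<lambda>z. measure_pmf.expectation (E x) (\<lambda>y. \<phi>' y z)))"
    if \<phi>': "\<phi>' \<in> Phi_med k Y X" for \<phi>'
  proof -
    obtain q where q: "\<phi>' = phi_med k Y q" using \<phi>' by (auto simp: Phi_med_def)
    let ?f = "\<lambda>x z. measure_pmf.expectation (E x) (\<lambda>y. \<phi>' y z)"
    have fin: "finite (set_pmf (D x))" if "x \<in> strats X" for x
      by (rule sharingD(1) [OF D that])
    have "(\<lambda>x. ?f x z) \<in> lin X" for z
    proof (rule lin_cong)
      show "(\<lambda>x. \<Sum>zs\<in>listset (replicate k (leaves Y)). q (z # zs) *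
          measure_pmf.expectation (D x) (\<lambda>ys. \<Prod>i<k. share_vec k ys (zs ! i))) \<in> lin X"
        by (rule lin_sum) (rule share_vec_monomial_lin [OF k wf D], simp add: Y_def)
      fix x assume "x \<in> strats X"
      then show "?f x z = (\<Sum>zs\<in>listset (replicate k (leaves Y)). q (z # zs) *
          measure_pmf.expectation (D x) (\<lambda>ys. \<Prod>i<k. share_vec k ys (zs ! i)))"
        by (simp add: E_def q phi_med_def expectation_sum_finite [OF fin])
    qed
    then obtain L where L: "linear_fn L" "\<And>x. x \<in> strats X \<Longrightarrow> L x = ?f x"
      using lin_realize [of ?f X] by blast
    have "?f x \<in> cohull (strats X)" if x: "x \<in> strats X" for x
    proof -
      have finE: "finite (set_pmf (E x))" using fin [OF x] by (simp add: E_def)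
      have "?f x = (\<lambda>z. \<Sum>y\<in>set_pmf (E x). pmf (E x) y * \<phi>' y z)"
        by (rule ext, subst integral_measure_pmf [OF finE]) auto
      also have "\<dots> \<in> cohull (strats X)"
        by (rule cohull_convex [OF finite_strats finE])
           (use phi_med_in_cohull [OF \<phi>' E_strat [OF x]] sum_pmf_eq_1 [OF finE] in auto)
      finally show ?thesis .
    qed
    then show ?thesis using L by (intro exI [of _ L]) auto
  qed
  show ?thesis
    by (rule exI [of _ Y], rule exI [of _ \<phi>], rule exI [of _ E])
       (use wf_share_root [OF k wf, folded Y_def] \<phi> \<phi>_strat E_strat decode dev in auto)
qed

section \<open>From one player to the game\<close>

lemma util_cong: "(\<And>j. j < n \<Longrightarrow> xs j = ys j) \<Longrightarrow> util n T U i xs = util n T U i ys"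
  unfolding util_def by (auto intro!: sum.cong prod.cong)

text \<open>Utility is linear in the vector of player \<open>i\<close>, so only the expected vector
  counts.\<close>

lemma expectation_util:
  assumes "finite (set_pmf p)" "i < n"
  shows "measure_pmf.expectation p (\<lambda>y. util n T U i (x(i := f y))) =
    util n T U i (x(i := (\<lambda>z. measure_pmf.expectation p (\<lambda>y. f y z))))"
proof -
  have *: "(\<Prod>j<n. (x(i := v)) j (zs j)) = v (zs i) * (\<Prod>j\<in>{..<n} - {i}. x j (zs j))" for v :: vec and zs
    using assms(2) by (subst prod.remove [of _ i]) (auto intro!: prod.cong)
  show ?thesis
    unfolding util_def * by (simp add: expectation_sum_finite [OF assms(1)])
qed

text \<open>Given a profile drawn from \<pi>, the players' strategies are encoded independently. The
  others decode correctly whatever player \<open>i\<close> does, so a mediator deviation of player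
  \<open>i\<close> has the same expected utility as its linear map \<open>L\<close> applied under
  \<pi>.\<close>

theorem mainTheorem18:
  fixes n k :: nat and \<epsilon> :: real
    and T :: "nat \<Rightarrow> tree"
    and U :: "nat \<Rightarrow> (nat \<Rightarrow> nat list) \<Rightarrow> real"
    and \<pi> :: "(nat \<Rightarrow> vec) pmf"
  assumes "k \<ge> 1" and "\<epsilon> \<ge> 0"
    and "\<forall>i < n. wf_tree (T i)"
    and "set_pmf \<pi> \<subseteq> PiE {..<n} (\<lambda>i. strats (T i))"
    and "lin_swap_eq n T U \<pi> \<epsilon>"
  shows "\<exists>Y :: nat \<Rightarrow> tree. \<exists>\<phi> :: nat \<Rightarrow> vec \<Rightarrow> vec. \<exists>\<pi>' :: (nat \<Rightarrow> vec) pmf.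
           (\<forall>i < n. wf_tree (Y i)) \<and>
           (\<forall>i < n. \<phi> i \<in> Phi_med k (Y i) (T i)) \<and>
           (\<forall>i < n. \<phi> i ` strats (Y i) \<subseteq> strats (T i)) \<and>
           set_pmf \<pi>' \<subseteq> PiE {..<n} (\<lambda>i. strats (Y i)) \<and>
           gen_med_eq n T U k Y \<phi> \<pi>' \<epsilon> \<and>
           map_pmf (\<lambda>y. restrict (\<lambda>i. \<phi> i (y i)) {..<n}) \<pi>' = \<pi>"
proof -
  define enc where "enc i Y \<phi> E \<longleftrightarrow> wf_tree Y \<and> \<phi> \<in> Phi_med k Y (T i) \<and> \<phi> ` strats Y \<subseteq> strats (T i) \<and>
    (\<forall>x\<in>strats (T i). set_pmf (E x) \<subseteq> strats Y \<and> (\<forall>y\<in>set_pmf (E x). \<phi> y = x)) \<and>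
    (\<forall>\<phi>'\<in>Phi_med k Y (T i). \<exists>L. linear_fn L \<and> L ` strats (T i) \<subseteq> cohull (strats (T i)) \<and>
       (\<forall>x\<in>strats (T i). L x = (\<lambda>z. measure_pmf.expectation (E x) (\<lambda>y. \<phi>' y z))))"
    for i Y \<phi> and E :: "vec \<Rightarrow> vec pmf"
  have "\<exists>Y \<phi> E. enc i Y \<phi> E" if "i < n" for i
    unfolding enc_def by (rule mediator_encoding) (use assms that in auto)
  then obtain Y \<phi> E where enc: "\<And>i. i < n \<Longrightarrow> enc i (Y i) (\<phi> i) (E i)" by metis
  have wfY: "\<And>i. i < n \<Longrightarrow> wf_tree (Y i)"
    and \<phi>: "\<And>i. i < n \<Longrightarrow> \<phi> i \<in> Phi_med k (Y i) (T i)"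
    and \<phi>_strat: "\<And>i. i < n \<Longrightarrow> \<phi> i ` strats (Y i) \<subseteq> strats (T i)"
    and E: "\<And>i x. i < n \<Longrightarrow> x \<in> strats (T i) \<Longrightarrow> set_pmf (E i x) \<subseteq> strats (Y i)"
    and decode: "\<And>i x y. i < n \<Longrightarrow> x \<in> strats (T i) \<Longrightarrow> y \<in> set_pmf (E i x) \<Longrightarrow> \<phi> i y = x"
    and dev: "\<And>i \<phi>'. i < n \<Longrightarrow> \<phi>' \<in> Phi_med k (Y i) (T i) \<Longrightarrow>
      \<exists>L. linear_fn L \<and> L ` strats (T i) \<subseteq> cohull (strats (T i)) \<and>
       (\<forall>x\<in>strats (T i). L x = (\<lambda>z. measure_pmf.expectation (E i x) (\<lambda>y. \<phi>' y z)))"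
    using enc unfolding enc_def by blast+
  define P where "P x = Pi_pmf {..<n} undefined (\<lambda>i. E i (x i))" for x
  define \<pi>' where "\<pi>' = bind_pmf \<pi> P"
  have x_strat: "x i \<in> strats (T i)" if "x \<in> set_pmf \<pi>" "i < n" for x i
    using assms(4) that by (auto simp: PiE_def)
  have P_E: "y i \<in> set_pmf (E i (x i))" if "y \<in> set_pmf (P x)" "i < n" for x y i
    using that by (auto simp: P_def set_Pi_pmf PiE_dflt_def)
  have P_ext: "y \<in> extensional {..<n}" if "y \<in> set_pmf (P x)" for x y
    using that by (auto simp: P_def set_Pi_pmf PiE_dflt_def extensional_def)
  have P_decode: "\<phi> i (y i) = x i" if "x \<in> set_pmf \<pi>" "y \<in> set_pmf (P x)" "i < n" for x y i
    using decode [OF that(3) x_strat [OF that(1,3)] P_E [OF that(2,3)]] .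
  have fin_\<pi>: "finite (set_pmf \<pi>)"
    by (rule finite_subset [OF assms(4)]) (auto intro!: finite_PiE finite_strats)
  have fin_E: "finite (set_pmf (E i x))" if "i < n" "x \<in> strats (T i)" for i x
    by (rule finite_subset [OF E [OF that] finite_strats])
  have fin_P: "finite (set_pmf (P x))" if "x \<in> set_pmf \<pi>" for x
    using that fin_E x_strat by (auto simp: P_def set_Pi_pmf)
  have bind: "measure_pmf.expectation \<pi>' f =
      measure_pmf.expectation \<pi> (\<lambda>x. measure_pmf.expectation (P x) f)" for f :: "_ \<Rightarrow> real"
    unfolding \<pi>'_def using fin_\<pi> fin_P
    by (subst pmf_expectation_bind [of "set_pmf \<pi>"], simp_all)
       (subst integral_measure_pmf [OF fin_\<pi>], auto)
  have "set_pmf \<pi>' \<subseteq> PiE {..<n} (\<lambda>i. strats (Y i))"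
  proof
    fix y assume "y \<in> set_pmf \<pi>'"
    then obtain x where x: "x \<in> set_pmf \<pi>" and y: "y \<in> set_pmf (P x)" by (auto simp: \<pi>'_def)
    have "y i \<in> strats (Y i)" if "i < n" for i
      using E [OF that x_strat [OF x that]] P_E [OF y that] by blast
    then show "y \<in> PiE {..<n} (\<lambda>i. strats (Y i))" using P_ext [OF y] by (simp add: PiE_def Pi_def)
  qed
  moreover have "map_pmf (\<lambda>y. restrict (\<lambda>i. \<phi> i (y i)) {..<n}) \<pi>' = \<pi>"
  proof -
    have "map_pmf (\<lambda>y. restrict (\<lambda>i. \<phi> i (y i)) {..<n}) (P x) = return_pmf x" if x: "x \<in> set_pmf \<pi>" for x
    proof -
      have "restrict (\<lambda>i. \<phi> i (y i)) {..<n} = x" if "y \<in> set_pmf (P x)" for y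
        using P_decode [OF x that] assms(4) x by (intro extensionalityI [of _ "{..<n}"]) (auto simp: PiE_def)
      then have "map_pmf (\<lambda>y. restrict (\<lambda>i. \<phi> i (y i)) {..<n}) (P x) = map_pmf (\<lambda>_. x) (P x)"
        by (intro map_pmf_cong) auto
      then show ?thesis by (simp add: map_pmf_const)
    qed
    then have "map_pmf (\<lambda>y. restrict (\<lambda>i. \<phi> i (y i)) {..<n}) \<pi>' = bind_pmf \<pi> return_pmf"
      unfolding \<pi>'_def map_bind_pmf by (intro bind_pmf_cong) auto
    then show ?thesis by (simp add: bind_return_pmf')
  qed
  moreover have "gen_med_eq n T U k Y \<phi> \<pi>' \<epsilon>"
    unfolding gen_med_eq_def
  proof (intro allI impI ballI)
    fix i \<phi>' assume i: "i < n" and \<phi>': "\<phi>' \<in> Phi_med k (Y i) (T i)"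
    obtain L where L: "linear_fn L" "L ` strats (T i) \<subseteq> cohull (strats (T i))"
      and L_eq: "\<And>x. x \<in> strats (T i) \<Longrightarrow> L x = (\<lambda>z. measure_pmf.expectation (E i x) (\<lambda>y. \<phi>' y z))"
      using dev [OF i \<phi>'] by blast
    have "measure_pmf.expectation (P x) (\<lambda>y. util n T U i (\<lambda>j. if j = i then \<phi>' (y i) else \<phi> j (y j))) =
        util n T U i (x(i := L (x i)))" if x: "x \<in> set_pmf \<pi>" for x
    proof -
      have "measure_pmf.expectation (P x) (\<lambda>y. util n T U i (\<lambda>j. if j = i then \<phi>' (y i) else \<phi> j (y j))) =
          measure_pmf.expectation (P x) (\<lambda>y. util n T U i (x(i := \<phi>' (y i))))"
        by (rule expectation_cong, rule util_cong) (use P_decode [OF x] in auto)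
      also have "\<dots> = measure_pmf.expectation (map_pmf (\<lambda>y. y i) (P x)) (\<lambda>v. util n T U i (x(i := \<phi>' v)))"
        by simp
      also have "map_pmf (\<lambda>y. y i) (P x) = E i (x i)"
        using i by (simp add: P_def Pi_pmf_component)
      also have "measure_pmf.expectation (E i (x i)) (\<lambda>v. util n T U i (x(i := \<phi>' v))) =
          util n T U i (x(i := L (x i)))"
        using expectation_util [OF fin_E [OF i x_strat [OF x i]] i] L_eq [OF x_strat [OF x i]] by simp
      finally show ?thesis .
    qed
    then have "measure_pmf.expectation \<pi>' (\<lambda>y. util n T U i (\<lambda>j. if j = i then \<phi>' (y i) else \<phi> j (y j))) =
        measure_pmf.expectation \<pi> (\<lambda>x. util n T U i (x(i := L (x i))))"
      unfolding bind by (rule expectation_cong)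
    also have "\<dots> \<le> measure_pmf.expectation \<pi> (\<lambda>x. util n T U i x) + \<epsilon>"
      using assms(5) i L unfolding lin_swap_eq_def by blast
    also have "measure_pmf.expectation \<pi> (\<lambda>x. util n T U i x) =
        measure_pmf.expectation \<pi>' (\<lambda>y. util n T U i (\<lambda>j. \<phi> j (y j)))"
      unfolding bind
    proof (rule expectation_cong)
      fix x assume x: "x \<in> set_pmf \<pi>"
      have "measure_pmf.expectation (P x) (\<lambda>y. util n T U i (\<lambda>j. \<phi> j (y j))) =
          measure_pmf.expectation (P x) (\<lambda>y. util n T U i x)"
        by (rule expectation_cong, rule util_cong) (use P_decode [OF x] in auto)
      then show "util n T U i x = measure_pmf.expectation (P x) (\<lambda>y. util n T U i (\<lambda>j. \<phi> j (y j)))"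
        by simp
    qed
    finally show "measure_pmf.expectation \<pi>' (\<lambda>y. util n T U i (\<lambda>j. if j = i then \<phi>' (y i) else \<phi> j (y j)))
        \<le> measure_pmf.expectation \<pi>' (\<lambda>y. util n T U i (\<lambda>j. \<phi> j (y j))) + \<epsilon>" .
  qed
  ultimately show ?thesis using wfY \<phi> \<phi>_strat by blast
qed

end
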